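(* Let $n\ge 5$, let $\Omega=\Omega_1\times\cdots\times\Omega_n$ where each $\Omega_i$ is a closed subinterval of the real line, and let $f$ be a smooth convex function from an open neighborhood of $\Omega$ to $\mathbb{R}$ whose set $S$ of minimizers over $\Omega$ is nonempty. Let $x_0\in\Omega$ and let $(x_j)_{j\ge0}$ and $(\bar{x}_{j+1})_{j\ge 0}$ be the sequences of the asynchronous stochastic coordinate descent iteration (defined in the context, separable constrained case) with steplength parameter $\gamma>0$ and delay bound $\tau$. Let $\rho$ be a constant with $\rho>\left(1-2/\sqrt{n}\right)^{-1}$, and define $$\psi:= 1+\frac{L_{\mathrm{res}}\tau\rho^{\tau}}{\sqrt{n}\,L_{\max}}\left(2 +\frac{L_{\max}}{\sqrt{n}\,L_{\mathrm{res}}} + \frac{2\tau}{n}\right).$$ Suppose that $\gamma>0$ satisfies the two upper bounds $$\gamma \le \frac{1}{\psi},\qquad \gamma \le \left(1-\frac{1}{\rho}-\frac{2}{\sqrt{n}}\right)\frac{\sqrt{n}\,L_{\max}}{4L_{\mathrm{res}}\tau\rho^{\tau}}.$$ Then $$\mathbb{E}\|x_{j-1}-\bar{x}_j\|^2 \le \rho\, \mathbb{E} \|x_j-\bar{x}_{j+1}\|^2, \qquad j=1,2,\dots.$$ If the essential strong convexity property (defined in the context) holds with parameter $l>0$, then for $j=1,2,\dots$ $$\mathbb{E} \|x_{j} - \mathcal{P}_S(x_{j})\|^2 + \frac{2\gamma}{L_{\max}}(\mathbb{E} f(x_{j}) - f^* ) \le \left(1- \frac{l} {n(l+\gamma^{-1}L_{\max})}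 \right)^{j} \left( R_0^2 + \frac{2\gamma}{L_{\max}}(f(x_0) - f^* )\right),$$ where $R_0:=\|x_0-\mathcal{P}_S(x_0)\|$. For general smooth convex $f$, $$\mathbb{E} f(x_{j})- f^* \le \frac{n\left(R_0^2L_{\max}+ 2\gamma(f(x_0)- f^* )\right)}{2\gamma (n+j)}.$$
   Context: Notation: $\|\cdot\|$ is the Euclidean norm, $e_i$ the $i$th standard basis vector, $\nabla_i f(x)$ the $i$th component of $\nabla f(x)$. $S\subset\Omega$ is the set on which $f$ attains its minimum over $\Omega$ (assumed nonempty), $f^*$ the optimal value; $\mathcal{P}_S$ and $\mathcal{P}_\Omega$ are Euclidean projections onto $S$ and $\Omega$. Lipschitz constants: $L_{\mathrm{res}}$ is the restricted Lipschitz constant of $\nabla f$: $\|\nabla f(x)-\nabla f(x+te_i)\|\le L_{\mathrm{res}}|t|$ for all $i=1,\dots,n$ and $t\in\mathbb{R}$ with $x,x+te_i\in\Omega$. $L_i$ is the coordinate Lipschitz constant of $\nabla f$ in the $i$th coordinate direction: $f(x+te_i)-f(x)\le \nabla_i f(x)\,t+\frac{L_i}{2}t^2$ whenever $x,x+te_i\in\Omega$, or equivalently $|\nabla_i f(x)-\nabla_i f(x+te_i)|\le L_i|t|$. $L_{\max}:=\max_{i=1,\dots,n} L_i$. One has $L_{\mathrm{res}}\ge L_{\max}$. Essential strong convexity with parameter $l>0$: $f(x)-f(y)\ge\langle\nabla f(y),x-y\rangle+\frac{l}{2}\|x-y\|^2$ for all $x,y\in\Omega$ with $\mathcal{P}_S(x)=\mathcal{P}_S(y)$.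 Iteration (separable constrained case): several processors update a shared vector $x$ without synchronization; $x_j$ is the state of $x$ after $j$ updates. Starting from $x_0\in\Omega$, at each step $j=0,1,2,\dots$ an index $i(j)$ is chosen at random from $\{1,\dots,n\}$ with equal probability, and $$x_{j+1}=\mathcal{P}_\Omega\left(x_j-\frac{\gamma}{L_{\max}}\,e_{i(j)}\nabla_{i(j)}f(x_{k(j)})\right),$$ where $k(j)$ is the index of the iterate at which the update applied at step $j$ was calculated. It satisfies $k(j)\le j$, and the delay is assumed to be bounded uniformly by a positive integer $\tau$: $j-k(j)\le\tau$ for all $j$. The hypothesized full update, obtained by applying the single-component update to every component of $x_j$, is $$\bar{x}_{j+1}:=\arg\min_{x\in\Omega}\ \langle\nabla f(x_{k(j)}),x-x_j\rangle+\frac{L_{\max}}{2\gamma}\|x-x_j\|^2,\qquad j=0,1,2,\dots$$ The indices $i(j)$ are random variables, and $\mathbb{E}$ denotes expectation over all random variables. *)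

theory Defs
  imports "HOL-Probability.Probability"
begin

definition interval_box :: "('n::finite \<Rightarrow> real set) \<Rightarrow> (real ^ 'n) set" where
  "interval_box I = {x. \<forall>i. x $ i \<in> I i}"

definition minimizers :: "('a \<Rightarrow> real) \<Rightarrow> 'a set \<Rightarrow> 'a set" where
  "minimizers f \<Omega> = {x. is_arg_min f (\<lambda>y. y \<in> \<Omega>) x}"

text \<open>Throughout, the argument \<open>g\<close> stands for the gradient field of \<open>f\<close>, and \<open>axis i 1\<close> is the
  \<open>i\<close>-th standard basis vector. The Lipschitz predicates hold for every admissible constant,
  the least one included.\<close>

definition restricted_lipschitz ::
  "(real ^ 'n \<Rightarrow> real ^ 'n::finite) \<Rightarrow> (real ^ 'n) set \<Rightarrow> real \<Rightarrow> bool" where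
  "restricted_lipschitz g \<Omega> L \<longleftrightarrow>
     (\<forall>i t. \<forall>x\<in>\<Omega>. x + t *\<^sub>R axis i 1 \<in> \<Omega> \<longrightarrow>
        norm (g x - g (x + t *\<^sub>R axis i 1)) \<le> L * \<bar>t\<bar>)"

definition coordinate_lipschitz ::
  "(real ^ 'n \<Rightarrow> real) \<Rightarrow> (real ^ 'n \<Rightarrow> real ^ 'n::finite) \<Rightarrow> (real ^ 'n) set \<Rightarrow> 'n \<Rightarrow> real \<Rightarrow> bool" where
  "coordinate_lipschitz f g \<Omega> i L \<longleftrightarrow>
     (\<forall>t. \<forall>x\<in>\<Omega>. x + t *\<^sub>R axis i 1 \<in> \<Omega> \<longrightarrow>
        f (x + t *\<^sub>R axis i 1) - f x \<le> g x $ i * t + L / 2 * t\<^sup>2)"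

definition essentially_strongly_convex ::
  "(real ^ 'n \<Rightarrow> real) \<Rightarrow> (real ^ 'n \<Rightarrow> real ^ 'n::finite) \<Rightarrow> (real ^ 'n) set \<Rightarrow> real \<Rightarrow> bool" where
  "essentially_strongly_convex f g \<Omega> l \<longleftrightarrow>
     (\<forall>x\<in>\<Omega>. \<forall>y\<in>\<Omega>.
        closest_point (minimizers f \<Omega>) x = closest_point (minimizers f \<Omega>) y \<longrightarrow>
        f x - f y \<ge> g y \<bullet> (x - y) + l / 2 * (norm (x - y))\<^sup>2)"

text \<open>In the following two updates, \<open>y\<close> is the current iterate, \<open>z\<close> the (possibly older) iterate
  at which the gradient was read, and \<open>L\<close> the constant that scales the steplength.\<close>

definition coordinate_update ::
  "(real ^ 'n \<Rightarrow> real ^ 'n::finite) \<Rightarrow> (real ^ 'n) set \<Rightarrow> real \<Rightarrow> real \<Rightarrow> 'n \<Rightarrow> real ^ 'n \<Rightarrow> real ^ 'n \<Rightarrow> real ^ 'n" where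
  "coordinate_update g \<Omega> \<gamma> L i y z = closest_point \<Omega> (y - (\<gamma> / L * (g z $ i)) *\<^sub>R axis i 1)"

definition full_update ::
  "(real ^ 'n \<Rightarrow> real ^ 'n::finite) \<Rightarrow> (real ^ 'n) set \<Rightarrow> real \<Rightarrow> real \<Rightarrow> real ^ 'n \<Rightarrow> real ^ 'n \<Rightarrow> real ^ 'n" where
  "full_update g \<Omega> \<gamma> L y z =
     arg_min_on (\<lambda>x. g z \<bullet> (x - y) + L / (2 * \<gamma>) * (norm (x - y))\<^sup>2) \<Omega>"

end

theory Submission
  imports Defs
begin

text \<open>
  Write \<open>D j\<close> for the difference between \<open>x j\<close> and the full update at step \<open>j\<close>, and \<open>A j\<close> for the
  expectation of its squared length. Projection onto a box acts on each coordinate separately, so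
  step \<open>j\<close> moves \<open>x j\<close> by one uniformly chosen coordinate of \<open>D j\<close>, a move of expected squared
  length \<open>A j / n\<close>. Consecutive full updates differ only through one such move and through at most
  \<open>\<tau> + 1\<close> moves of the gradient argument; hence \<open>A j - A (j + 1)\<close> is at most \<open>1 / sqrt n\<close> times
  a combination of \<open>A j\<close> and the preceding values, and strong induction gives \<open>A j \<le> \<rho> * A (j + 1)\<close>.

  Consequently every error caused by a stale gradient is at most a multiple of \<open>\<rho> ^ \<tau> * A j\<close>, and
  the first steplength bound says exactly that the negative term \<open>- A j / n\<close> in the expected change
  of the squared distance to the minimizers absorbs all of them. So
  \<open>V j = E (dist (x j) S)^2 + 2 \<gamma> / Lmax * (E f (x j) - fstar)\<close> drops by at least
  \<open>2 \<gamma> / (n * Lmax) * (E f (x j) - fstar)\<close> in each step. The sublinear rate follows by summation,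
  because \<open>E f (x j)\<close> is nonincreasing; the linear rate follows because essential strong convexity
  bounds the squared distance by \<open>2 / l * (f - fstar)\<close>.
\<close>

section \<open>Projections onto convex sets and onto boxes\<close>

text \<open>Sum of the two obtuse-angle inequalities of the projections, each tested at the other
  projected point.\<close>

lemma closest_point_firmly_nonexpansive:
  fixes K :: "'a::euclidean_space set"
  assumes "convex K" "closed K" "K \<noteq> {}"
  shows "(norm (closest_point K a - closest_point K b))\<^sup>2
    \<le> (a - b) \<bullet> (closest_point K a - closest_point K b)"
  using closest_point_dot[of K "closest_point K b" a] closest_point_dot[of K "closest_point K a" b]
    closest_point_in_set[of K] assms
  by (simp add: power2_norm_eq_inner inner_diff_left inner_diff_right inner_commute)

text \<open>Firm nonexpansiveness makes the residual 1-Lipschitz in the base point, where plain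
  nonexpansiveness of the projection would only give the constant 2.\<close>

lemma norm_diff_projection_residual_le:
  fixes K :: "'a::euclidean_space set"
  assumes K: "convex K" "closed K" "K \<noteq> {}"
  shows "norm ((y - closest_point K (y - u)) - (z - closest_point K (z - v)))
    \<le> norm (y - z) + norm (u - v)"
proof -
  \<comment> \<open>\<open>?q\<close> combines the base point \<open>z\<close> with the shift
    \<open>u\<close>: from \<open>?p\<close> to \<open>?q\<close> only the base point changes, from
    \<open>?q\<close> to \<open>?r\<close> only the shift.\<close>
  let ?p = "closest_point K (y - u)" and ?q = "closest_point K (z - u)"
    and ?r = "closest_point K (z - v)"
  \<comment> \<open>To be used with \<open>w = y - z\<close> and \<open>e = ?p - ?q\<close>, where
    the premise is firm nonexpansiveness.\<close>
  have "norm (w - e) \<le> norm w" if "(norm e)\<^sup>2 \<le> w \<bullet> e" for w e :: 'a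
  proof (rule power2_le_imp_le)
    have "(norm (w - e))\<^sup>2 = (norm w)\<^sup>2 - 2 * (w \<bullet> e) + (norm e)\<^sup>2"
      by (simp add: power2_norm_eq_inner inner_diff_left inner_diff_right inner_commute)
    then show "(norm (w - e))\<^sup>2 \<le> (norm w)\<^sup>2"
      using that zero_le_power2[of "norm e"] by linarith
  qed simp
  then have 1: "norm ((y - z) - (?p - ?q)) \<le> norm (y - z)"
    using closest_point_firmly_nonexpansive[OF K, of "y - u" "z - u"] by simp
  have "norm (?q - ?r) \<le> norm ((z - u) - (z - v))"
    using closest_point_lipschitz[OF K] unfolding dist_norm .
  then have 2: "norm (?q - ?r) \<le> norm (u - v)"
    by (simp add: norm_minus_commute[of u])
  have "(y - ?p) - (z - ?r) = ((y - z) - (?p - ?q)) - (?q - ?r)"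
    by simp
  then have "norm ((y - ?p) - (z - ?r)) \<le> norm ((y - z) - (?p - ?q)) + norm (?q - ?r)"
    by (simp only: norm_triangle_ineq4)
  then show ?thesis
    using 1 2 by linarith
qed

section \<open>Boxes and their coordinatewise projections\<close>

lemma closed_interval_box:
  fixes I :: "'n::finite \<Rightarrow> real set"
  assumes "\<And>c. closed (I c)"
  shows "closed (interval_box I)"
proof -
  have "closed ((\<lambda>x :: real ^ 'n. x $ c) -` I c)" for c
    using assms by (intro continuous_closed_vimage) (simp_all add: continuous_component)
  then show ?thesis
    unfolding interval_box_def vimage_def by (rule closed_Collect_all)
qed

lemma convex_interval_box: "(\<And>c. is_interval (I c)) \<Longrightarrow> convex (interval_box I)"
  unfolding interval_box_def convex_def is_interval_convex_1 by auto

text \<open>The vector of coordinate projections is at least as close to \<open>v\<close> in every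
  coordinate as any point of the box, hence also in norm; nearest points in closed convex sets are
  unique.\<close>

lemma closest_point_interval_box:
  assumes I: "\<And>c. closed (I c)" "\<And>c. is_interval (I c)" and ne: "interval_box I \<noteq> {}"
  shows "closest_point (interval_box I) v $ c = closest_point (I c) (v $ c)"
proof -
  define p where "p = (\<chi> c. closest_point (I c) (v $ c))"
  have Ic: "I c \<noteq> {}" for c
    using ne unfolding interval_box_def by auto
  have "p = closest_point (interval_box I) v"
  proof (rule closest_point_unique)
    show "p \<in> interval_box I"
      unfolding p_def interval_box_def using closest_point_in_set[OF I(1) Ic] by simp
    show "\<forall>z\<in>interval_box I. dist v p \<le> dist v z"
    proof
      fix z assume z: "z \<in> interval_box I"
      show "dist v p \<le> dist v z"
        unfolding dist_norm
      proof (rule norm_le_componentwise_cart)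
        fix c
        show "norm ((v - p) $ c) \<le> norm ((v - z) $ c)"
          using closest_point_le[OF I(1), of "z $ c" c "v $ c"] z
          unfolding p_def interval_box_def dist_norm by simp
      qed
    qed
  qed (use I in \<open>simp_all add: convex_interval_box closed_interval_box\<close>)
  then show ?thesis
    unfolding p_def by (metis vec_lambda_beta)
qed

text \<open>The step shifts \<open>y\<close> in coordinate \<open>c\<close> only. The other
  coordinates already lie in their intervals and stay fixed, while coordinate \<open>c\<close> is
  projected just as in the full step.\<close>

lemma coordinate_update_eq:
  assumes I: "\<And>c. closed (I c)" "\<And>c. is_interval (I c)" and y: "y \<in> interval_box I"
  shows "coordinate_update g (interval_box I) \<gamma> L c y z
    = y - ((y - closest_point (interval_box I) (y - (\<gamma> / L) *\<^sub>R g z)) $ c) *\<^sub>R axis c 1"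
proof -
  have ne: "interval_box I \<noteq> {}" using y by auto
  have self: "closest_point (I b) (y $ b) = y $ b" for b
    using y unfolding interval_box_def by (intro closest_point_self) simp
  show ?thesis
    unfolding coordinate_update_def vec_eq_iff
    by (auto simp: closest_point_interval_box[OF I ne] self axis_def)
qed

text \<open>Completing the square turns the objective into a positive multiple of the squared
  distance to the gradient step, up to a constant.\<close>

lemma full_update_eq:
  assumes K: "convex K" "closed K" "K \<noteq> {}" and pos: "\<gamma> > 0" "L > 0"
  shows "full_update g K \<gamma> L y z = closest_point K (y - (\<gamma> / L) *\<^sub>R g z)"
proof -
  define q where "q x = g z \<bullet> (x - y) + L / (2 * \<gamma>) * (norm (x - y))\<^sup>2" for x
  define a where "a = y - (\<gamma> / L) *\<^sub>R g z"
  have q: "q x = L / (2 * \<gamma>) * (dist a x)\<^sup>2 - \<gamma> / (2 * L) * (norm (g z))\<^sup>2" for x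
  proof -
    define w where "w = x - y"
    have "a - x = - (w + (\<gamma> / L) *\<^sub>R g z)"
      unfolding a_def w_def by simp
    then have "dist a x = norm (w + (\<gamma> / L) *\<^sub>R g z)"
      unfolding dist_norm by (simp only: norm_minus_cancel)
    moreover have "(norm (w + (\<gamma> / L) *\<^sub>R g z))\<^sup>2
        = (norm w)\<^sup>2 + 2 * (\<gamma> / L) * (g z \<bullet> w) + (\<gamma> / L)\<^sup>2 * (norm (g z))\<^sup>2"
      unfolding power2_norm_eq_inner
      by (simp add: inner_add_left inner_add_right inner_commute power2_eq_square)
    moreover have "L / (2 * \<gamma>) * (N + 2 * (\<gamma> / L) * G + (\<gamma> / L)\<^sup>2 * H) - \<gamma> / (2 * L) * H
        = G + L / (2 * \<gamma>) * N" for N G H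
      using pos by (simp add: field_simps power2_eq_square)
    ultimately show ?thesis
      unfolding q_def w_def by (simp only:)
  qed
  have le: "q u \<le> q w \<longleftrightarrow> dist a u \<le> dist a w" for u w
  proof -
    have "L / (2 * \<gamma>) > 0" using pos by simp
    then have "q u \<le> q w \<longleftrightarrow> (dist a u)\<^sup>2 \<le> (dist a w)\<^sup>2"
      unfolding q diff_le_eq diff_add_cancel by (rule mult_le_cancel_left_pos)
    then show ?thesis by simp
  qed
  \<comment> \<open>The arg min is a choice among minimizers; uniqueness of the nearest point
    identifies it.\<close>
  let ?m = "SOME x. is_arg_min q (\<lambda>x. x \<in> K) x"
  have "is_arg_min q (\<lambda>x. x \<in> K) (closest_point K a)"
    using closest_point_exists[OF K(2,3), of a] unfolding is_arg_min_linorder le by auto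
  then have "is_arg_min q (\<lambda>x. x \<in> K) ?m"
    by (rule someI)
  then have "?m = closest_point K a"
    unfolding is_arg_min_linorder le by (intro closest_point_unique[OF K(1,2)]) auto
  then show ?thesis
    unfolding full_update_def arg_min_on_def arg_min_def a_def q_def .
qed

section \<open>Convex functions and their minimizers\<close>

lemma GDERIV_along_line:
  fixes f :: "'a::real_inner \<Rightarrow> real"
  assumes "GDERIV f y :> d"
  shows "((\<lambda>t. f (y + t *\<^sub>R v)) has_real_derivative d \<bullet> v) (at 0)"
proof -
  have 1: "(f has_derivative (\<lambda>h. h \<bullet> d)) (at (y + 0 *\<^sub>R v))"
    using assms unfolding gderiv_def by simp
  have 2: "((\<lambda>t. y + t *\<^sub>R v) has_derivative (\<lambda>t. t *\<^sub>R v)) (at 0)"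
    by (auto intro!: derivative_eq_intros)
  have "((\<lambda>t. f (y + t *\<^sub>R v)) has_derivative (\<lambda>t. (t *\<^sub>R v) \<bullet> d)) (at 0)"
    using has_derivative_compose[OF 2 1] .
  moreover have "(\<lambda>t. (t *\<^sub>R v) \<bullet> d) = (*) (d \<bullet> v)"
    by (simp add: fun_eq_iff inner_commute mult.commute)
  ultimately show ?thesis
    unfolding has_field_derivative_def by simp
qed

text \<open>Restriction to the line through \<open>y\<close> and \<open>x\<close> reduces the claim
  to the tangent inequality in one variable.\<close>

lemma convex_on_ge_linearization:
  fixes f :: "'a::real_inner \<Rightarrow> real"
  assumes U: "open U" "convex_on U f" and "x \<in> U" "y \<in> U" and d: "GDERIV f y :> d"
  shows "f x \<ge> f y + d \<bullet> (x - y)"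
proof -
  \<comment> \<open>The parameters whose points stay in \<open>U\<close>: an open interval
    containing 0 and 1.\<close>
  define A where "A = (\<lambda>t. y + t *\<^sub>R (x - y)) -` U"
  have cU: "convex U"
    using U(2) unfolding convex_on_def by simp
  have comb: "y + (u * s + w * t) *\<^sub>R (x - y)
      = u *\<^sub>R (y + s *\<^sub>R (x - y)) + w *\<^sub>R (y + t *\<^sub>R (x - y))" if "u + w = 1" for u w s t :: real
  proof -
    have "y = (u + w) *\<^sub>R y" using that by simp
    then show ?thesis by (simp add: algebra_simps)
  qed
  have "convex A"
    unfolding A_def convex_def using cU by (auto simp: comb convex_def)
  moreover have "f (y + (u * s + w * t) *\<^sub>R (x - y))
      \<le> u * f (y + s *\<^sub>R (x - y)) + w * f (y + t *\<^sub>R (x - y))"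
    if "s \<in> A" "t \<in> A" "u \<ge> 0" "w \<ge> 0" "u + w = 1" for u w s t
    using U(2) that unfolding A_def convex_on_def by (simp add: comb)
  ultimately have "convex_on A (\<lambda>t. f (y + t *\<^sub>R (x - y)))"
    unfolding convex_on_def by simp
  moreover have "open A"
    unfolding A_def by (intro continuous_open_vimage U) (intro continuous_intros)
  ultimately have "f (y + 1 *\<^sub>R (x - y)) - f (y + 0 *\<^sub>R (x - y)) \<ge> d \<bullet> (x - y) * (1 - 0)"
    using assms(3,4)
    by (intro convex_on_imp_above_tangent[of A])
       (auto simp: A_def interior_open convex_connected \<open>convex A\<close>[unfolded A_def]
         intro: has_field_derivative_at_within GDERIV_along_line[OF d])
  then show ?thesis by simp
qed

text \<open>A negative derivative at \<open>p\<close> towards \<open>x\<close> would make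
  \<open>f\<close> smaller at nearby points of the segment, which lies in \<open>K\<close>.\<close>

lemma minimizer_variational_inequality:
  fixes f :: "'a::real_inner \<Rightarrow> real"
  assumes "convex K" and p: "p \<in> minimizers f K" and "x \<in> K" and d: "GDERIV f p :> d"
  shows "d \<bullet> (x - p) \<ge> 0"
proof (rule ccontr)
  assume "\<not> ?thesis"
  then obtain e where e: "e > 0" "\<And>h. 0 < h \<Longrightarrow> h < e \<Longrightarrow> f (p + h *\<^sub>R (x - p)) < f p"
    using DERIV_neg_dec_right[OF GDERIV_along_line[OF d, of "x - p"]] by auto
  \<comment> \<open>Below \<open>e\<close> for the strict decrease, at most 1 to stay on the
    segment.\<close>
  define h where "h = min (e / 2) 1"
  have h: "0 < h" "h < e" "h \<le> 1" unfolding h_def using e(1) by auto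
  have pK: "p \<in> K" and min: "\<And>y. y \<in> K \<Longrightarrow> f p \<le> f y"
    using p unfolding minimizers_def is_arg_min_linorder by auto
  have "p + h *\<^sub>R (x - p) = (1 - h) *\<^sub>R p + h *\<^sub>R x"
    by (simp add: algebra_simps)
  also have "\<dots> \<in> K"
    using h pK assms(1,3) by (intro convexD_alt) auto
  finally show False
    using min e(2)[OF h(1,2)] by fastforce
qed

lemma closed_minimizers:
  fixes f :: "'a::t2_space \<Rightarrow> real"
  assumes "closed K" "continuous_on K f"
  shows "closed (minimizers f K)"
\<comment> \<open>The minimizers are the intersection of the sublevel sets for all values on
  \<open>K\<close>; over empty \<open>K\<close> that intersection would be the whole space.\<close>
proof (cases "K = {}")
  case False
  then have "minimizers f K = (\<Inter>y\<in>K. K \<inter> f -` {..f y})"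
    unfolding minimizers_def is_arg_min_linorder by auto
  moreover have "closed (\<Inter>y\<in>K. K \<inter> f -` {..f y})"
    by (intro closed_INT ballI continuous_closed_preimage assms closed_atMost)
  ultimately show ?thesis
    by simp
qed (simp add: minimizers_def is_arg_min_linorder)

section \<open>Random indices\<close>

text \<open>Being a function of the first \<open>j\<close> indices, stated pointwise instead of
  through a generated sigma-algebra. As the indices take finitely many values, this alone will give
  measurability and integrability.\<close>

definition determined_by_past ::
  "'w measure \<Rightarrow> (nat \<Rightarrow> 'w \<Rightarrow> 'n) \<Rightarrow> nat \<Rightarrow> ('w \<Rightarrow> 'b) \<Rightarrow> bool" where
  "determined_by_past M i j F \<longleftrightarrow>
     (\<forall>\<omega>\<in>space M. \<forall>\<omega>'\<in>space M. (\<forall>m<j. i m \<omega> = i m \<omega>') \<longrightarrow> F \<omega> = F \<omega>')"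

lemma determined_by_pastD:
  "determined_by_past M i j F \<Longrightarrow> \<omega> \<in> space M \<Longrightarrow> \<omega>' \<in> space M \<Longrightarrow>
   \<forall>m<j. i m \<omega> = i m \<omega>' \<Longrightarrow> F \<omega> = F \<omega>'"
  unfolding determined_by_past_def by blast

lemma determined_by_past_mono:
  "determined_by_past M i j F \<Longrightarrow> j \<le> j' \<Longrightarrow> determined_by_past M i j' F"
  unfolding determined_by_past_def by (meson order_less_le_trans)

lemma determined_by_past_cong:
  "(\<And>\<omega>. \<omega> \<in> space M \<Longrightarrow> F \<omega> = G \<omega>) \<Longrightarrow> determined_by_past M i j F = determined_by_past M i j G"
  unfolding determined_by_past_def by simp

lemma determined_by_past_index: "determined_by_past M i (Suc j) (i j)"
  unfolding determined_by_past_def by simp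

lemma determined_by_past_const: "determined_by_past M i j (\<lambda>_. a)"
  unfolding determined_by_past_def by simp

lemma determined_by_past_compose:
  "determined_by_past M i j F \<Longrightarrow> determined_by_past M i j (\<lambda>\<omega>. h (F \<omega>))"
  unfolding determined_by_past_def by metis

lemma determined_by_past_compose2:
  "determined_by_past M i j F \<Longrightarrow> determined_by_past M i j G \<Longrightarrow>
   determined_by_past M i j (\<lambda>\<omega>. h (F \<omega>) (G \<omega>))"
  unfolding determined_by_past_def by metis

locale uniform_indices = prob_space M
  for M :: "'w measure" and i :: "nat \<Rightarrow> 'w \<Rightarrow> 'n::finite" +
  assumes indep: "indep_vars (\<lambda>_. count_space UNIV) i UNIV"
    and uniform: "measure M {\<omega> \<in> space M. i j \<omega> = c} = 1 / real CARD('n)"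
begin

abbreviation "past \<equiv> determined_by_past M i"

text \<open>\<open>h\<close> evaluates \<open>F\<close> at an arbitrarily chosen outcome with the
  given history; all such outcomes give the same value.\<close>

lemma past_factors:
  assumes "past j F"
  obtains h where "\<And>\<omega>. \<omega> \<in> space M \<Longrightarrow> F \<omega> = h (restrict (\<lambda>m. i m \<omega>) {..<j})"
proof -
  define h where "h r = F (SOME \<omega>'. \<omega>' \<in> space M \<and> restrict (\<lambda>m. i m \<omega>') {..<j} = r)" for r
  show thesis
  proof (rule that)
    fix \<omega> assume "\<omega> \<in> space M"
    define \<omega>' where "\<omega>' = (SOME \<omega>'. \<omega>' \<in> space M \<and>
      restrict (\<lambda>m. i m \<omega>') {..<j} = restrict (\<lambda>m. i m \<omega>) {..<j})"
    have w: "\<omega>' \<in> space M \<and> restrict (\<lambda>m. i m \<omega>') {..<j} = restrict (\<lambda>m. i m \<omega>) {..<j}"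
      unfolding \<omega>'_def by (rule someI[of _ \<omega>]) (use \<open>\<omega> \<in> space M\<close> in auto)
    have "i m \<omega> = i m \<omega>'" if "m < j" for m
      using fun_cong[OF conjunct2[OF w], of m] that by simp
    then show "F \<omega> = h (restrict (\<lambda>m. i m \<omega>) {..<j})"
      using assms w \<open>\<omega> \<in> space M\<close> unfolding determined_by_past_def h_def \<omega>'_def by blast
  qed
qed

lemma measurable_index [measurable]: "i j \<in> measurable M (count_space UNIV)"
  using indep unfolding indep_vars_def by auto

text \<open>Histories of a fixed length carry the discrete sigma-algebra, so every function of a
  history is measurable.\<close>

lemma PiM_count_space_index:
  "PiM {..<j} (\<lambda>_. count_space (UNIV :: 'n set)) = count_space ({..<j::nat} \<rightarrow>\<^sub>E UNIV)"
  by (intro count_space_PiM_finite) auto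

lemma measurable_past:
  assumes "past j F"
  shows "F \<in> measurable M (count_space UNIV)"
proof -
  obtain h where h: "\<And>\<omega>. \<omega> \<in> space M \<Longrightarrow> F \<omega> = h (restrict (\<lambda>m. i m \<omega>) {..<j})"
    using past_factors[OF assms] by blast
  have "(\<lambda>\<omega>. restrict (\<lambda>m. i m \<omega>) {..<j}) \<in> measurable M (PiM {..<j} (\<lambda>_. count_space UNIV))"
    by (intro measurable_restrict) simp
  then have "(\<lambda>\<omega>. h (restrict (\<lambda>m. i m \<omega>) {..<j})) \<in> measurable M (count_space UNIV)"
    unfolding PiM_count_space_index by (rule measurable_compose) simp
  then show ?thesis
    using h by (simp cong: measurable_cong)
qed

lemma finite_image_past:
  assumes "past j F"
  shows "finite (F ` space M)"
proof -
  obtain h where h: "\<And>\<omega>. \<omega> \<in> space M \<Longrightarrow> F \<omega> = h (restrict (\<lambda>m. i m \<omega>) {..<j})"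
    using past_factors[OF assms] by blast
  have "F ` space M \<subseteq> h ` ({..<j} \<rightarrow>\<^sub>E UNIV)"
    using h by auto
  then show ?thesis
    by (rule finite_subset) (intro finite_imageI finite_PiE; simp)
qed

text \<open>\<open>F\<close> takes only finitely many values, so it is bounded.\<close>

lemma integrable_past:
  fixes F :: "'w \<Rightarrow> real"
  assumes "past j F"
  shows "integrable M F"
proof (rule integrable_const_bound[where B="Max ((\<lambda>\<omega>. \<bar>F \<omega>\<bar>) ` space M)"])
  have "finite ((\<lambda>\<omega>. \<bar>F \<omega>\<bar>) ` space M)"
    using finite_image_past[OF determined_by_past_compose[OF assms, of abs]] .
  then show "AE \<omega> in M. norm (F \<omega>) \<le> Max ((\<lambda>\<omega>. \<bar>F \<omega>\<bar>) ` space M)"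
    by (intro AE_I2) (simp add: Max_ge)
  show "F \<in> borel_measurable M"
    using measurable_compose[OF measurable_past[OF assms], of id borel] by (simp add: id_def)
qed

text \<open>This plays the role of a conditional expectation: index \<open>j\<close> is uniform and
  independent of the earlier ones, so a quantity fixed by the past is averaged over the
  coordinates.\<close>

lemma integral_at_index:
  fixes F :: "'w \<Rightarrow> 'n \<Rightarrow> real"
  assumes F: "past j F"
  shows "(\<integral>\<omega>. F \<omega> (i j \<omega>) \<partial>M) = (\<integral>\<omega>. (\<Sum>c\<in>UNIV. F \<omega> c) \<partial>M) / real CARD('n)"
proof -
  obtain h where h: "\<And>\<omega>. \<omega> \<in> space M \<Longrightarrow> F \<omega> = h (restrict (\<lambda>m. i m \<omega>) {..<j})"
    using past_factors[OF F] by blast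
  \<comment> \<open>\<open>F\<close> written through the history, the form in which independence of
    index \<open>j\<close> applies; the indicators \<open>J c\<close> then split the integral by the
    value of that index.\<close>
  define G where "G c \<omega> = h (restrict (\<lambda>m. i m \<omega>) {..<j}) c" for c \<omega>
  have G: "G c \<omega> = F \<omega> c" if "\<omega> \<in> space M" for c \<omega>
    using h[OF that] unfolding G_def by simp
  have past_G: "past j (G c)" for c
    using determined_by_past_compose[OF F, of "\<lambda>v. v c"] G
    by (simp cong: determined_by_past_cong)
  define J where "J c \<omega> = (if i j \<omega> = c then 1 else 0 :: real)" for c \<omega>
  have past_J: "past (Suc j) (J c)" for c
    unfolding J_def by (rule determined_by_past_compose[OF determined_by_past_index])
  have J: "(\<integral>\<omega>. J c \<omega> \<partial>M) = 1 / real CARD('n)" for c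
  proof -
    have "(\<integral>\<omega>. J c \<omega> \<partial>M) = (\<integral>\<omega>. indicator {\<omega> \<in> space M. i j \<omega> = c} \<omega> \<partial>M)"
      by (intro Bochner_Integration.integral_cong) (auto simp: J_def indicator_def)
    also have "\<dots> = measure M {\<omega> \<in> space M. i j \<omega> = c}"
      by simp
    finally show ?thesis
      using uniform by simp
  qed
  have indep_GJ: "indep_var borel (G c) borel (J c)" for c
  proof -
    have 1: "indep_var (PiM {..<j} (\<lambda>_. count_space UNIV)) (\<lambda>\<omega>. restrict (\<lambda>m. i m \<omega>) {..<j})
        (PiM {j} (\<lambda>_. count_space UNIV)) (\<lambda>\<omega>. restrict (\<lambda>m. i m \<omega>) {j})"
      by (rule indep_var_restrict[OF indep]) auto
    have "indep_var borel ((\<lambda>r. h r c) \<circ> (\<lambda>\<omega>. restrict (\<lambda>m. i m \<omega>) {..<j}))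
        borel ((\<lambda>r. if r j = c then 1 else 0 :: real) \<circ> (\<lambda>\<omega>. restrict (\<lambda>m. i m \<omega>) {j}))"
    proof (rule indep_var_compose[OF 1])
      show "(\<lambda>r. h r c) \<in> borel_measurable (PiM {..<j} (\<lambda>_. count_space UNIV))"
        unfolding PiM_count_space_index by simp
      show "(\<lambda>r. if r j = c then 1 else 0 :: real)
          \<in> borel_measurable (PiM {j} (\<lambda>_. count_space UNIV))"
        by measurable
    qed
    then show ?thesis
      by (simp add: G_def[abs_def] J_def[abs_def] comp_def cong: if_cong)
  qed
  have int: "integrable M (\<lambda>\<omega>. G c \<omega> * J c \<omega>)" for c
    by (rule integrable_past[of "Suc j"], rule determined_by_past_compose2[OF _ past_J])
       (rule determined_by_past_mono[OF past_G], simp)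
  have "(\<integral>\<omega>. F \<omega> (i j \<omega>) \<partial>M) = (\<integral>\<omega>. (\<Sum>c\<in>UNIV. G c \<omega> * J c \<omega>) \<partial>M)"
    by (intro Bochner_Integration.integral_cong) (auto simp: G J_def if_distrib cong: if_cong)
  also have "\<dots> = (\<Sum>c\<in>UNIV. \<integral>\<omega>. G c \<omega> * J c \<omega> \<partial>M)"
    using int by simp
  also have "\<dots> = (\<Sum>c\<in>UNIV. (\<integral>\<omega>. G c \<omega> \<partial>M) * (1 / real CARD('n)))"
    by (simp add: indep_var_lebesgue_integral[OF indep_GJ integrable_past[OF past_G]
          integrable_past[OF past_J]] J)
  also have "\<dots> = (\<integral>\<omega>. (\<Sum>c\<in>UNIV. G c \<omega>) \<partial>M) / real CARD('n)"
    by (simp add: integrable_past[OF past_G] sum_divide_distrib)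
  also have "(\<integral>\<omega>. (\<Sum>c\<in>UNIV. G c \<omega>) \<partial>M) = (\<integral>\<omega>. (\<Sum>c\<in>UNIV. F \<omega> c) \<partial>M)"
    by (intro Bochner_Integration.integral_cong) (simp_all add: G)
  finally show ?thesis .
qed

end

section \<open>The asynchronous process\<close>

text \<open>\<open>L\<close> is one constant that serves every coordinate, later the maximum. The
  two upper bounds on \<open>\<gamma>\<close> are multiplied out, in the form in which they are
  used.\<close>

locale async_coordinate_descent = uniform_indices M i
  for M :: "'w measure" and i :: "nat \<Rightarrow> 'w \<Rightarrow> 'n::finite" +
  fixes I :: "'n \<Rightarrow> real set" and \<Omega> U :: "(real ^ 'n) set"
    and f :: "real ^ 'n \<Rightarrow> real" and g :: "real ^ 'n \<Rightarrow> real ^ 'n"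
    and L Lr \<gamma> \<rho> N :: real and \<tau> :: nat and k :: "nat \<Rightarrow> nat"
    and x0 :: "real ^ 'n" and x :: "nat \<Rightarrow> 'w \<Rightarrow> real ^ 'n"
  assumes N: "N = real CARD('n)"
    and closed_I: "\<And>c. closed (I c)" and interval_I: "\<And>c. is_interval (I c)"
    and \<Omega>: "\<Omega> = interval_box I"
    and U: "open U" "\<Omega> \<subseteq> U"
    and convex_f: "convex_on U f"
    and gradient: "\<And>y. y \<in> U \<Longrightarrow> GDERIV f y :> g y"
    and Lr: "restricted_lipschitz g \<Omega> Lr" "Lr > 0"
    and L: "\<And>c. coordinate_lipschitz f g \<Omega> c L" "L > 0"
    and delay: "\<And>j. k j \<le> j" "\<And>j. j - k j \<le> \<tau>" and \<tau>: "\<tau> \<ge> 1"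
    and x0: "x0 \<in> \<Omega>"
    and x_0: "\<And>\<omega>. \<omega> \<in> space M \<Longrightarrow> x 0 \<omega> = x0"
    and x_Suc: "\<And>j \<omega>. \<omega> \<in> space M \<Longrightarrow>
          x (Suc j) \<omega> = coordinate_update g \<Omega> \<gamma> L (i j \<omega>) (x j \<omega>) (x (k j) \<omega>)"
    and \<gamma>: "\<gamma> > 0" and \<rho>: "\<rho> \<ge> 1"
    and \<gamma>_le1: "\<gamma> * (1 + Lr * real \<tau> * \<rho> ^ \<tau> / (sqrt N * L) *
          (2 + L / (sqrt N * Lr) + 2 * real \<tau> / N)) \<le> 1"
    and \<gamma>_le2: "\<gamma> * Lr / L * (4 * real \<tau> * \<rho> ^ \<tau>) \<le> (1 - 1 / \<rho> - 2 / sqrt N) * sqrt N"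
begin

text \<open>The projection form of \<open>x j - xbar (j + 1)\<close>, justified by
  \<open>full_update_eq\<close>; it gives access to single coordinates.\<close>

definition "D j \<omega> = x j \<omega> - closest_point \<Omega> (x j \<omega> - (\<gamma> / L) *\<^sub>R g (x (k j) \<omega>))"

definition "A j = (\<integral>\<omega>. (norm (D j \<omega>))\<^sup>2 \<partial>M)"

definition "step_length j \<omega> = norm (x j \<omega> - x (Suc j) \<omega>)"

section \<open>Feasibility of the iterates, single steps, and dependence on the indices\<close>

lemma N_pos: "N > 0"
  unfolding N by simp

lemma convex_\<Omega>: "convex \<Omega>" and closed_\<Omega>: "closed \<Omega>" and nonempty_\<Omega>: "\<Omega> \<noteq> {}"
  using x0 closed_I interval_I by (auto simp: \<Omega> convex_interval_box closed_interval_box)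

lemma x_in: "\<omega> \<in> space M \<Longrightarrow> x j \<omega> \<in> \<Omega>"
  using x0 x_0 x_Suc closest_point_in_set[OF closed_\<Omega> nonempty_\<Omega>]
  by (cases j) (simp_all add: coordinate_update_def)

lemma x_step:
  assumes "\<omega> \<in> space M"
  shows "x (Suc j) \<omega> = x j \<omega> - (D j \<omega> $ i j \<omega>) *\<^sub>R axis (i j \<omega>) 1"
  unfolding x_Suc[OF assms] D_def
  using coordinate_update_eq[of I, OF closed_I interval_I, folded \<Omega>, OF x_in[OF assms]] .

lemma step_length_eq: "\<omega> \<in> space M \<Longrightarrow> step_length j \<omega> = \<bar>D j \<omega> $ i j \<omega>\<bar>"
  unfolding step_length_def by (simp add: x_step)

lemma step_length_nonneg: "step_length j \<omega> \<ge> 0"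
  unfolding step_length_def by simp

text \<open>Strong induction, since the update reads both \<open>x m\<close> and the older
  \<open>x (k m)\<close>.\<close>

lemma past_x: "past j (x j)"
proof (induction j rule: less_induct)
  case (less j)
  show ?case
  proof (cases j)
    case 0
    then show ?thesis
      using x_0 unfolding determined_by_past_def by simp
  next
    case (Suc m)
    have p: "past j (x m)" "past j (x (k m))" "past j (i m)"
      using less[of m] less[of "k m"] delay(1)[of m] Suc determined_by_past_index[of M i m]
      by (auto intro: determined_by_past_mono)
    have "x j \<omega> = x j \<omega>'"
      if "\<omega> \<in> space M" "\<omega>' \<in> space M" "\<forall>m<j. i m \<omega> = i m \<omega>'" for \<omega> \<omega>'
      unfolding Suc x_Suc[OF that(1)] x_Suc[OF that(2)] p[THEN determined_by_pastD, OF that] ..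
    then show ?thesis
      unfolding determined_by_past_def by blast
  qed
qed

lemma past_x_le: "m \<le> j \<Longrightarrow> past j (x m)"
  using past_x determined_by_past_mono by blast

lemma past_D: "m \<le> j \<Longrightarrow> past j (D m)"
  unfolding D_def[abs_def] using delay(1)[of m] past_x_le
  by (intro determined_by_past_compose2[where F="x m" and G="x (k m)"
        and h="\<lambda>y z. y - closest_point \<Omega> (y - (\<gamma> / L) *\<^sub>R g z)"]) auto

lemma past_step_length: "m < j \<Longrightarrow> past j (step_length m)"
  unfolding step_length_def[abs_def]
  by (rule determined_by_past_compose2[where F="x m" and G="x (Suc m)"
        and h="\<lambda>y z. norm (y - z)"]; rule past_x_le) simp_all

lemma past_sum: "(\<And>m. m \<in> B \<Longrightarrow> past j (F m)) \<Longrightarrow> past j (\<lambda>\<omega>. \<Sum>m\<in>B. F m \<omega>)"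
  unfolding determined_by_past_def by (intro ballI impI sum.cong refl) blast

lemmas past_intros = past_x_le past_D past_step_length past_sum determined_by_past_const
  determined_by_past_compose[where h="norm :: real ^ 'n \<Rightarrow> real"]
  determined_by_past_compose[where h="\<lambda>a. a\<^sup>2"]
  determined_by_past_compose[where h="f"] determined_by_past_compose[where h="g"]
  determined_by_past_compose[where h="\<lambda>a. closest_point K a" for K]
  determined_by_past_compose[where h="\<lambda>a. a $ c" for c]
  determined_by_past_compose2[where h="(-)"]
  determined_by_past_compose2[where h="(*)"] determined_by_past_compose2[where h="(\<bullet>)"]

text \<open>The obtuse-angle inequality of the projection onto \<open>I c\<close>, with
  \<open>x j - D j\<close> as the projected point. Taking \<open>x j\<close> itself for
  \<open>p\<close> controls the decrease of \<open>f\<close>; taking a minimizer controls the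
  distance.\<close>

lemma variational_inequality:
  assumes "\<omega> \<in> space M" "p \<in> \<Omega>"
  shows "(p $ c - x j \<omega> $ c + D j \<omega> $ c) * D j \<omega> $ c
    \<le> \<gamma> / L * (g (x (k j) \<omega>) $ c * (p $ c - x j \<omega> $ c + D j \<omega> $ c))"
proof -
  let ?v = "x j \<omega> - (\<gamma> / L) *\<^sub>R g (x (k j) \<omega>)"
  have D: "closest_point (I c) (?v $ c) = x j \<omega> $ c - D j \<omega> $ c"
    unfolding D_def using closest_point_interval_box[of I, OF closed_I interval_I, folded \<Omega>,
        OF nonempty_\<Omega>] by simp
  have "p $ c \<in> I c"
    using assms(2) unfolding \<Omega> interval_box_def by simp
  then have "(?v $ c - closest_point (I c) (?v $ c)) \<bullet> (p $ c - closest_point (I c) (?v $ c)) \<le> 0"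
    using closed_I interval_I by (intro closest_point_dot) (simp_all add: is_interval_convex_1)
  then show ?thesis
    unfolding inner_real_def D by (simp add: algebra_simps)
qed

lemma A_nonneg: "A j \<ge> 0"
  unfolding A_def by simp

lemma norm_power2_eq_sum: "(norm (v :: real ^ 'n))\<^sup>2 = (\<Sum>c\<in>UNIV. (v $ c)\<^sup>2)"
  unfolding power2_norm_eq_inner inner_vec_def by (simp add: power2_eq_square)

section \<open>Expected step lengths and gradient differences\<close>

lemma expectation_step_length_power2: "(\<integral>\<omega>. (step_length j \<omega>)\<^sup>2 \<partial>M) = A j / N"
proof -
  have "(\<integral>\<omega>. (step_length j \<omega>)\<^sup>2 \<partial>M) = (\<integral>\<omega>. (\<lambda>c. (D j \<omega> $ c)\<^sup>2) (i j \<omega>) \<partial>M)"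
    by (intro Bochner_Integration.integral_cong) (simp_all add: step_length_eq)
  also have "\<dots> = (\<integral>\<omega>. (\<Sum>c\<in>UNIV. (D j \<omega> $ c)\<^sup>2) \<partial>M) / N"
    unfolding N by (rule integral_at_index) (rule determined_by_past_compose[OF past_D], simp)
  finally show ?thesis
    unfolding A_def norm_power2_eq_sum .
qed

lemma integrable_cross: "integrable M (\<lambda>\<omega>. step_length m \<omega> * norm (D e \<omega>))"
  by (rule integrable_past[of "Suc (max m e)"]) (intro past_intros; simp)

lemma integrable_D: "integrable M (\<lambda>\<omega>. (norm (D e \<omega>))\<^sup>2)"
  by (rule integrable_past[of e]) (intro past_intros; simp)

lemma integrable_step_length: "integrable M (\<lambda>\<omega>. (step_length m \<omega>)\<^sup>2)"
  by (rule integrable_past[of "Suc m"]) (intro past_intros; simp)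

text \<open>AM-GM with weight \<open>sqrt N\<close>: a single random coordinate carries only a fraction \<open>1 / N\<close> of
  the squared length of the full update.\<close>

lemma expectation_cross_le: "(\<integral>\<omega>. step_length m \<omega> * norm (D e \<omega>) \<partial>M) \<le> (A m + A e) / (2 * sqrt N)"
proof -
  have "(\<integral>\<omega>. step_length m \<omega> * norm (D e \<omega>) \<partial>M)
      \<le> (\<integral>\<omega>. sqrt N / 2 * (step_length m \<omega>)\<^sup>2 + 1 / (2 * sqrt N) * (norm (D e \<omega>))\<^sup>2 \<partial>M)"
  proof (intro integral_mono integrable_cross Bochner_Integration.integrable_add
      integrable_mult_right integrable_D integrable_step_length)
    fix \<omega>
    define a b s where "a = step_length m \<omega>" and "b = norm (D e \<omega>)" and "s = sqrt N"
    have s: "s > 0" unfolding s_def using N_pos by simp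
    have "0 \<le> (s * a - b)\<^sup>2 / (2 * s)"
      using s by simp
    also have "\<dots> = s / 2 * a\<^sup>2 + 1 / (2 * s) * b\<^sup>2 - a * b"
      using s by (simp add: field_simps power2_eq_square)
    finally show "step_length m \<omega> * norm (D e \<omega>)
        \<le> sqrt N / 2 * (step_length m \<omega>)\<^sup>2 + 1 / (2 * sqrt N) * (norm (D e \<omega>))\<^sup>2"
      unfolding a_def b_def s_def by simp
  qed
  also have "\<dots> = sqrt N / 2 * (A m / N) + 1 / (2 * sqrt N) * A e"
    using integrable_step_length integrable_D by (simp add: expectation_step_length_power2 A_def)
  also have "\<dots> = (A m + A e) / (2 * sqrt N)"
    using real_sqrt_mult_self[of N] N_pos by (simp add: field_simps)
  finally show ?thesis .
qed

text \<open>Consecutive iterates differ in one coordinate, so the restricted Lipschitz constant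
  applies to each step, and the triangle inequality adds up the steps.\<close>

lemma gradient_diff_le_aux:
  assumes "\<omega> \<in> space M" "a \<le> b"
  shows "norm (g (x a \<omega>) - g (x b \<omega>)) \<le> Lr * (\<Sum>m\<in>{a..<b}. step_length m \<omega>)"
  using assms(2)
proof (induction b rule: dec_induct)
  case (step b)
  have "x b \<omega> + (- D b \<omega> $ i b \<omega>) *\<^sub>R axis (i b \<omega>) 1 = x (Suc b) \<omega>"
    using x_step[OF assms(1), of b] by simp
  then have "norm (g (x b \<omega>) - g (x (Suc b) \<omega>)) \<le> Lr * \<bar>- D b \<omega> $ i b \<omega>\<bar>"
    using Lr(1) x_in[OF assms(1)] unfolding restricted_lipschitz_def by metis
  then have "norm (g (x b \<omega>) - g (x (Suc b) \<omega>)) \<le> Lr * step_length b \<omega>"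
    using step_length_eq[OF assms(1), of b] by simp
  then show ?case
    using step norm_triangle_ineq[of "g (x a \<omega>) - g (x b \<omega>)" "g (x b \<omega>) - g (x (Suc b) \<omega>)"]
    by (simp add: algebra_simps)
qed simp

text \<open>A common window from \<open>p\<close> to \<open>q\<close> allows either order of
  \<open>a\<close> and \<open>b\<close>: the read indices of consecutive steps need not be
  monotone.\<close>

lemma gradient_diff_le:
  assumes "\<omega> \<in> space M" "p \<le> a" "p \<le> b" "a \<le> q" "b \<le> q"
  shows "norm (g (x a \<omega>) - g (x b \<omega>)) \<le> Lr * (\<Sum>m\<in>{p..<q}. step_length m \<omega>)"
proof -
  have *: "norm (g (x a \<omega>) - g (x b \<omega>)) \<le> Lr * (\<Sum>m\<in>{p..<q}. step_length m \<omega>)"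
    if "a \<le> b" "p \<le> a" "b \<le> q" for a b
    using gradient_diff_le_aux[OF assms(1) that(1)]
  proof (rule order_trans)
    show "Lr * (\<Sum>m\<in>{a..<b}. step_length m \<omega>) \<le> Lr * (\<Sum>m\<in>{p..<q}. step_length m \<omega>)"
      using Lr(2) that by (intro mult_left_mono sum_mono2) (auto simp: step_length_nonneg)
  qed
  show ?thesis
    using *[of a b] *[of b a] assms by (cases "a \<le> b") (simp_all add: norm_minus_commute)
qed

section \<open>Consecutive full updates have comparable lengths\<close>

lemma D_diff_le:
  assumes "\<omega> \<in> space M"
  shows "norm (D d \<omega> - D (Suc d) \<omega>)
    \<le> step_length d \<omega> + \<gamma> * Lr / L * (\<Sum>m\<in>{d - \<tau>..d}. step_length m \<omega>)"
proof -
  have "norm ((\<gamma> / L) *\<^sub>R g (x (k d) \<omega>) - (\<gamma> / L) *\<^sub>R g (x (k (Suc d)) \<omega>))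
      = \<gamma> / L * norm (g (x (k d) \<omega>) - g (x (k (Suc d)) \<omega>))"
    using \<gamma> L(2) by (simp flip: scaleR_diff_right)
  \<comment> \<open>Both read indices lie between \<open>d - \<tau>\<close> and
    \<open>Suc d\<close>, a window of at most \<open>\<tau> + 1\<close> steps.\<close>
  also have "\<dots> \<le> \<gamma> / L * (Lr * (\<Sum>m\<in>{d - \<tau>..<Suc d}. step_length m \<omega>))"
    using delay[of d] delay[of "Suc d"] \<gamma> L(2)
    by (intro mult_left_mono gradient_diff_le assms) auto
  finally have "norm ((\<gamma> / L) *\<^sub>R g (x (k d) \<omega>) - (\<gamma> / L) *\<^sub>R g (x (k (Suc d)) \<omega>))
      \<le> \<gamma> * Lr / L * (\<Sum>m\<in>{d - \<tau>..d}. step_length m \<omega>)"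
    by (simp add: atLeastLessThanSuc_atLeastAtMost)
  then show ?thesis
    using norm_diff_projection_residual_le[OF convex_\<Omega> closed_\<Omega> nonempty_\<Omega>, of "x d \<omega>"
        "(\<gamma> / L) *\<^sub>R g (x (k d) \<omega>)" "x (Suc d) \<omega>" "(\<gamma> / L) *\<^sub>R g (x (k (Suc d)) \<omega>)"]
    unfolding D_def step_length_def by linarith
qed

text \<open>The difference of squares reduces to products of a step length with
  \<open>norm (D d)\<close>, and each of these gains a factor \<open>1 / sqrt N\<close> in
  expectation.\<close>

lemma A_diff_le:
  "A d - A (Suc d) \<le> (2 * A d + \<gamma> * Lr / L * (\<Sum>m\<in>{d - \<tau>..d}. A m + A d)) / sqrt N"
proof -
  let ?c = "\<gamma> * Lr / L"
  have "A d - A (Suc d) = (\<integral>\<omega>. (norm (D d \<omega>))\<^sup>2 - (norm (D (Suc d) \<omega>))\<^sup>2 \<partial>M)"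
    unfolding A_def using integrable_D by simp
  also have "\<dots> \<le> (\<integral>\<omega>. 2 * (step_length d \<omega> * norm (D d \<omega>)
      + ?c * (\<Sum>m\<in>{d - \<tau>..d}. step_length m \<omega> * norm (D d \<omega>))) \<partial>M)"
  proof (rule integral_mono)
    fix \<omega> assume \<omega>: "\<omega> \<in> space M"
    \<comment> \<open>The two sides differ by the squared norm of
      \<open>D d - D (Suc d)\<close>.\<close>
    have "(norm (D d \<omega>))\<^sup>2 - (norm (D (Suc d) \<omega>))\<^sup>2
        \<le> 2 * (D d \<omega> \<bullet> (D d \<omega> - D (Suc d) \<omega>))"
      using inner_ge_zero[of "D d \<omega> - D (Suc d) \<omega>"]
      by (simp add: power2_norm_eq_inner inner_diff_left inner_diff_right inner_commute)
    also have "\<dots> \<le> 2 * (norm (D d \<omega>) * norm (D d \<omega> - D (Suc d) \<omega>))"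
      using norm_cauchy_schwarz by simp
    also have "\<dots> \<le> 2 * (norm (D d \<omega>) * (step_length d \<omega> + ?c * (\<Sum>m\<in>{d - \<tau>..d}. step_length m \<omega>)))"
      by (intro mult_left_mono D_diff_le[OF \<omega>]) auto
    also have "\<dots> = 2 * (step_length d \<omega> * norm (D d \<omega>)
        + ?c * (\<Sum>m\<in>{d - \<tau>..d}. step_length m \<omega> * norm (D d \<omega>)))"
      by (simp add: algebra_simps sum_distrib_left)
    finally show "(norm (D d \<omega>))\<^sup>2 - (norm (D (Suc d) \<omega>))\<^sup>2 \<le> \<dots>" .
  qed (intro Bochner_Integration.integrable_diff integrable_mult_right
      Bochner_Integration.integrable_add Bochner_Integration.integrable_sum
      integrable_cross integrable_D)+
  also have "\<dots> = 2 * ((\<integral>\<omega>. step_length d \<omega> * norm (D d \<omega>) \<partial>M)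
      + ?c * (\<Sum>m\<in>{d - \<tau>..d}. \<integral>\<omega>. step_length m \<omega> * norm (D d \<omega>) \<partial>M))"
    using integrable_cross by simp
  also have "\<dots> \<le> 2 * ((A d + A d) / (2 * sqrt N)
      + ?c * (\<Sum>m\<in>{d - \<tau>..d}. (A m + A d) / (2 * sqrt N)))"
    using \<gamma> L(2) Lr(2)
    by (intro mult_left_mono add_mono sum_mono expectation_cross_le) auto
  also have "(\<Sum>m\<in>{d - \<tau>..d}. (A m + A d) / (2 * sqrt N))
      = (\<Sum>m\<in>{d - \<tau>..d}. A m + A d) / (2 * sqrt N)"
    by (simp add: sum_divide_distrib)
  finally show ?thesis
    by (simp add: add_divide_distrib distrib_left)
qed

lemma \<rho>_powers: "1 \<le> \<rho> ^ m" "m \<le> \<tau> \<Longrightarrow> \<rho> ^ m \<le> \<rho> ^ \<tau>"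
  using \<rho> by (auto intro: power_increasing)

text \<open>The ratios before \<open>d\<close> bound the window in \<open>A_diff_le\<close> by
  multiples of \<open>\<rho> ^ \<tau> * A d\<close>; the second steplength bound turns this into a
  relative decrease of at most \<open>1 - 1 / \<rho>\<close>.\<close>

lemma A_ratio: "A d \<le> \<rho> * A (Suc d)"
proof (induction d rule: less_induct)
  case (less d)
  have pow: "A (d - m) \<le> \<rho> ^ m * A d" if "m \<le> d" for m
    using that
  proof (induction m)
    case (Suc m)
    have "A (d - Suc m) \<le> \<rho> * A (d - m)"
      using less[of "d - Suc m"] Suc.prems by (simp add: Suc_diff_Suc)
    also have "\<dots> \<le> \<rho> * (\<rho> ^ m * A d)"
      using Suc \<rho> by (intro mult_left_mono) auto
    finally show ?case by simp
  qed simp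
  have pow': "A m + A d \<le> 2 * \<rho> ^ \<tau> * A d" if "m \<in> {d - \<tau>..<d}" for m
  proof -
    have "A m \<le> \<rho> ^ (d - m) * A d"
      using pow[of "d - m"] that by simp
    also have "\<dots> \<le> \<rho> ^ \<tau> * A d"
      using that by (intro mult_right_mono \<rho>_powers A_nonneg) auto
    finally show ?thesis
      using mult_right_mono[OF \<rho>_powers(1)[of \<tau>] A_nonneg[of d]] by simp
  qed
  have "(\<Sum>m\<in>{d - \<tau>..d}. A m + A d) = (\<Sum>m\<in>{d - \<tau>..<d}. A m + A d) + 2 * A d"
    by (simp add: sum.last_plus)
  also have "(\<Sum>m\<in>{d - \<tau>..<d}. A m + A d) \<le> real (card {d - \<tau>..<d}) * (2 * \<rho> ^ \<tau> * A d)"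
    by (rule sum_bounded_above) (rule pow')
  also have "\<dots> \<le> real \<tau> * (2 * \<rho> ^ \<tau> * A d)"
    using A_nonneg[of d] \<rho> by (intro mult_right_mono) auto
  \<comment> \<open>The summand \<open>m = d\<close> is enlarged to the size of the rest, which
    produces the factor 4 of the steplength bound; this uses \<open>\<tau> \<ge> 1\<close>.\<close>
  also have "2 * A d \<le> real \<tau> * (2 * \<rho> ^ \<tau> * A d)"
  proof -
    have "1 * 1 \<le> real \<tau> * \<rho> ^ \<tau>"
      using \<tau> \<rho>_powers(1)[of \<tau>] by (intro mult_mono) auto
    then show ?thesis
      using mult_right_mono[OF _ A_nonneg[of d]] by fastforce
  qed
  finally have "(\<Sum>m\<in>{d - \<tau>..d}. A m + A d) \<le> 4 * real \<tau> * \<rho> ^ \<tau> * A d"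
    by simp
  then have "\<gamma> * Lr / L * (\<Sum>m\<in>{d - \<tau>..d}. A m + A d)
      \<le> \<gamma> * Lr / L * (4 * real \<tau> * \<rho> ^ \<tau> * A d)"
    using \<gamma> L(2) Lr(2) by (intro mult_left_mono) auto
  also have "\<dots> \<le> (1 - 1 / \<rho> - 2 / sqrt N) * sqrt N * A d"
    using mult_right_mono[OF \<gamma>_le2 A_nonneg[of d]] by (simp only: mult.assoc)
  \<comment> \<open>The part \<open>- 2 / sqrt N\<close> of the bound cancels the direct
    contribution \<open>2 * A d\<close> of the step itself.\<close>
  finally have "A d - A (Suc d) \<le> (2 * A d + (1 - 1 / \<rho> - 2 / sqrt N) * sqrt N * A d) / sqrt N"
    using A_diff_le[of d] by (smt (verit) divide_right_mono real_sqrt_ge_zero N_pos)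
  also have "\<dots> = (1 - 1 / \<rho>) * A d"
    using N_pos by (simp add: field_simps)
  finally show ?case
    using \<rho> by (simp add: field_simps)
qed

lemma A_le:
  assumes "j - \<tau> \<le> m" "m \<le> j"
  shows "A m \<le> \<rho> ^ \<tau> * A j"
proof -
  have "A m \<le> \<rho> ^ (j - m) * A j"
    using assms(2)
  proof (induction j rule: dec_induct)
    case (step j)
    have "\<rho> ^ (j - m) * A j \<le> \<rho> ^ (j - m) * (\<rho> * A (Suc j))"
      using \<rho> by (intro mult_left_mono A_ratio) auto
    then show ?case
      using step by (simp add: Suc_diff_le mult_ac)
  qed simp
  also have "\<dots> \<le> \<rho> ^ \<tau> * A j"
    using assms by (intro mult_right_mono \<rho>_powers A_nonneg) auto
  finally show ?thesis .
qed

section \<open>Expected decrease\<close>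

text \<open>At most \<open>\<tau>\<close> steps separate the read from \<open>d\<close>, and each
  contributes a cross term in which \<open>A m\<close> and \<open>A d\<close> are at most
  \<open>\<rho> ^ \<tau> * A j\<close>. The case \<open>d = j\<close> concerns the current step,
  smaller \<open>d\<close> the steps taken since the read.\<close>

lemma expectation_gradient_error_le:
  assumes "k j \<le> d" "d \<le> j"
  shows "\<bar>\<integral>\<omega>. (g (x (k j) \<omega>) - g (x d \<omega>)) \<bullet> D d \<omega> \<partial>M\<bar> \<le> real \<tau> * Lr * \<rho> ^ \<tau> / sqrt N * A j"
proof -
  let ?F = "\<lambda>\<omega>. (g (x (k j) \<omega>) - g (x d \<omega>)) \<bullet> D d \<omega>"
  have int: "integrable M ?F"
    by (rule integrable_past[of d]) (intro past_intros; use assms in simp)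
  have "\<bar>\<integral>\<omega>. ?F \<omega> \<partial>M\<bar> \<le> (\<integral>\<omega>. \<bar>?F \<omega>\<bar> \<partial>M)"
    by (rule integral_abs_bound)
  also have "\<dots> \<le> (\<integral>\<omega>. Lr * (\<Sum>m\<in>{k j..<d}. step_length m \<omega> * norm (D d \<omega>)) \<partial>M)"
  proof (rule integral_mono)
    fix \<omega> assume \<omega>: "\<omega> \<in> space M"
    have "\<bar>?F \<omega>\<bar> \<le> norm (g (x (k j) \<omega>) - g (x d \<omega>)) * norm (D d \<omega>)"
      by (rule Cauchy_Schwarz_ineq2)
    also have "\<dots> \<le> (Lr * (\<Sum>m\<in>{k j..<d}. step_length m \<omega>)) * norm (D d \<omega>)"
      using assms by (intro mult_right_mono gradient_diff_le[OF \<omega>]) auto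
    finally show "\<bar>?F \<omega>\<bar> \<le> Lr * (\<Sum>m\<in>{k j..<d}. step_length m \<omega> * norm (D d \<omega>))"
      by (simp add: sum_distrib_right mult.assoc)
  next
    show "integrable M (\<lambda>\<omega>. Lr * (\<Sum>m\<in>{k j..<d}. step_length m \<omega> * norm (D d \<omega>)))"
      by (intro integrable_mult_right Bochner_Integration.integrable_sum integrable_cross)
  qed (intro integrable_abs int)
  also have "\<dots> = Lr * (\<Sum>m\<in>{k j..<d}. \<integral>\<omega>. step_length m \<omega> * norm (D d \<omega>) \<partial>M)"
    using integrable_cross by simp
  also have "(\<Sum>m\<in>{k j..<d}. \<integral>\<omega>. step_length m \<omega> * norm (D d \<omega>) \<partial>M)
      \<le> real (card {k j..<d}) * (\<rho> ^ \<tau> * A j / sqrt N)"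
  proof (rule sum_bounded_above)
    fix m assume m: "m \<in> {k j..<d}"
    have "A m \<le> \<rho> ^ \<tau> * A j" "A d \<le> \<rho> ^ \<tau> * A j"
      using m assms delay(2)[of j] by (auto intro!: A_le)
    then have "(A m + A d) / (2 * sqrt N) \<le> (2 * (\<rho> ^ \<tau> * A j)) / (2 * sqrt N)"
      using N_pos by (intro divide_right_mono) auto
    then show "(\<integral>\<omega>. step_length m \<omega> * norm (D d \<omega>) \<partial>M) \<le> \<rho> ^ \<tau> * A j / sqrt N"
      using expectation_cross_le[of m d] by simp
  qed
  also have "\<dots> \<le> real \<tau> * (\<rho> ^ \<tau> * A j / sqrt N)"
    using delay(2)[of j] assms A_nonneg \<rho> N_pos by (intro mult_right_mono) auto
  finally show ?thesis
    using Lr(2) by (simp add: mult_ac)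
qed

lemma f_step_le:
  assumes \<omega>: "\<omega> \<in> space M"
  shows "f (x (Suc m) \<omega>) \<le> f (x m \<omega>) - g (x m \<omega>) $ i m \<omega> * D m \<omega> $ i m \<omega>
    + L / 2 * (D m \<omega> $ i m \<omega>)\<^sup>2"
proof -
  have "x m \<omega> + (- D m \<omega> $ i m \<omega>) *\<^sub>R axis (i m \<omega>) 1 = x (Suc m) \<omega>"
    using x_step[OF \<omega>, of m] by simp
  then have "f (x (Suc m) \<omega>) - f (x m \<omega>)
      \<le> g (x m \<omega>) $ i m \<omega> * (- D m \<omega> $ i m \<omega>) + L / 2 * (- D m \<omega> $ i m \<omega>)\<^sup>2"
    using L(1) x_in[OF \<omega>] unfolding coordinate_lipschitz_def by metis
  then show ?thesis by simp
qed

lemma integrable_f: "integrable M (\<lambda>\<omega>. f (x j \<omega>))"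
  by (rule integrable_past[of j]) (intro past_intros; simp)

text \<open>The factor of \<open>A j\<close> in
  \<open>expectation_gradient_error_le\<close>.\<close>

definition "stale_coeff = Lr * real \<tau> * \<rho> ^ \<tau> / sqrt N"

lemma stale_coeff_nonneg: "stale_coeff \<ge> 0"
  unfolding stale_coeff_def using Lr(2) \<rho> N_pos by simp

text \<open>The first steplength bound sorted by origin: curvature of the current step, its gradient
  error, then curvature and gradient errors of the up to \<open>\<tau>\<close> steps since the
  read.\<close>

lemma stale_bound:
  "\<gamma> * (1 + 2 * stale_coeff / L + real \<tau> * \<rho> ^ \<tau> / N + 2 * stale_coeff * real \<tau> / (N * L)) \<le> 1"
proof -
  define s where "s = sqrt N"
  have s: "s > 0" and ss: "N = s * s"
    unfolding s_def using N_pos by simp_all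
  have gc: "stale_coeff = Lr * real \<tau> * \<rho> ^ \<tau> / s"
    unfolding stale_coeff_def s_def ..
  have "Lr * real \<tau> * \<rho> ^ \<tau> / (sqrt N * L) * (2 + L / (sqrt N * Lr) + 2 * real \<tau> / N)
      = 2 * stale_coeff / L + real \<tau> * \<rho> ^ \<tau> / (sqrt N * sqrt N) + 2 * stale_coeff * real \<tau> / (N * L)"
    unfolding gc s_def[symmetric] unfolding ss using Lr(2) L(2) s by (simp add: field_simps)
  then show ?thesis
    using \<gamma>_le1 N_pos by (simp add: add.assoc)
qed

text \<open>Averaging the coordinate descent estimate over the index bounds the change by
  \<open>(L / 2 - L / \<gamma> + stale_coeff) * A j / N\<close>, which the steplength bound makes
  nonpositive.\<close>

lemma expectation_f_antimono_Suc: "(\<integral>\<omega>. f (x (Suc j) \<omega>) \<partial>M) \<le> (\<integral>\<omega>. f (x j \<omega>) \<partial>M)"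
proof -
  define F where "F \<omega> c = L / 2 * (D j \<omega> $ c)\<^sup>2 - g (x j \<omega>) $ c * D j \<omega> $ c" for \<omega> c
  have F: "past j F"
    using determined_by_past_compose2[OF past_x past_D[OF order_refl],
        of j "\<lambda>y e c. L / 2 * (e $ c)\<^sup>2 - g y $ c * e $ c"] unfolding F_def[abs_def] .
  have F': "past (Suc j) (\<lambda>\<omega>. F \<omega> (i j \<omega>))"
    by (rule determined_by_past_compose2[OF determined_by_past_mono[OF F]
          determined_by_past_index]) simp
  have gD: "integrable M (\<lambda>\<omega>. (g (x (k j) \<omega>) - g (x j \<omega>)) \<bullet> D j \<omega>)"
    by (rule integrable_past[of j]) (intro past_intros; use delay in simp)
  have "(\<integral>\<omega>. f (x (Suc j) \<omega>) \<partial>M) \<le> (\<integral>\<omega>. f (x j \<omega>) + F \<omega> (i j \<omega>) \<partial>M)"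
  proof (rule integral_mono)
    fix \<omega> assume "\<omega> \<in> space M"
    then show "f (x (Suc j) \<omega>) \<le> f (x j \<omega>) + F \<omega> (i j \<omega>)"
      using f_step_le[of \<omega> j] unfolding F_def by linarith
  qed (intro integrable_f Bochner_Integration.integrable_add integrable_past[OF F'])+
  also have "\<dots> = (\<integral>\<omega>. f (x j \<omega>) \<partial>M) + (\<integral>\<omega>. (\<Sum>c\<in>UNIV. F \<omega> c) \<partial>M) / N"
    using integrable_f integrable_past[OF F'] integral_at_index[OF F] N by simp
  also have "(\<integral>\<omega>. (\<Sum>c\<in>UNIV. F \<omega> c) \<partial>M)
      \<le> (\<integral>\<omega>. (L / 2 - L / \<gamma>) * (norm (D j \<omega>))\<^sup>2
          + (g (x (k j) \<omega>) - g (x j \<omega>)) \<bullet> D j \<omega> \<partial>M)"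
  proof (rule integral_mono)
    fix \<omega> assume \<omega>: "\<omega> \<in> space M"
    \<comment> \<open>From the variational inequality with \<open>p = x j\<close>; it yields the
      negative part \<open>- L / \<gamma>\<close>.\<close>
    have "L / \<gamma> * (D j \<omega> $ c)\<^sup>2 \<le> g (x (k j) \<omega>) $ c * D j \<omega> $ c" for c
    proof -
      have "D j \<omega> $ c * D j \<omega> $ c \<le> \<gamma> / L * (g (x (k j) \<omega>) $ c * D j \<omega> $ c)"
        using variational_inequality[OF \<omega> x_in[OF \<omega>, of j], of c j] by simp
      then show ?thesis
        using \<gamma> L(2) by (simp add: field_simps power2_eq_square)
    qed
    then have "F \<omega> c \<le> (L / 2 - L / \<gamma>) * (D j \<omega> $ c)\<^sup>2
        + (g (x (k j) \<omega>) - g (x j \<omega>)) $ c * D j \<omega> $ c" for c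
      unfolding F_def by (simp add: left_diff_distrib)
    then have "(\<Sum>c\<in>UNIV. F \<omega> c) \<le> (\<Sum>c\<in>UNIV. (L / 2 - L / \<gamma>) * (D j \<omega> $ c)\<^sup>2
        + (g (x (k j) \<omega>) - g (x j \<omega>)) $ c * D j \<omega> $ c)"
      by (rule sum_mono)
    then show "(\<Sum>c\<in>UNIV. F \<omega> c) \<le> (L / 2 - L / \<gamma>) * (norm (D j \<omega>))\<^sup>2
        + (g (x (k j) \<omega>) - g (x j \<omega>)) \<bullet> D j \<omega>"
      by (simp only: norm_power2_eq_sum inner_vec_def sum.distrib sum_distrib_left inner_real_def)
  next
    show "integrable M (\<lambda>\<omega>. \<Sum>c\<in>UNIV. F \<omega> c)"
      by (rule integrable_past[OF determined_by_past_compose[OF F]])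
  qed (intro Bochner_Integration.integrable_add integrable_mult_right integrable_D gD)
  also have "\<dots> = (L / 2 - L / \<gamma>) * A j + (\<integral>\<omega>. (g (x (k j) \<omega>) - g (x j \<omega>)) \<bullet> D j \<omega> \<partial>M)"
    using integrable_D gD by (simp add: A_def)
  also have "\<dots> \<le> (L / 2 - L / \<gamma>) * A j + stale_coeff * A j"
    using expectation_gradient_error_le[OF delay(1) order_refl, of j]
    unfolding stale_coeff_def by (simp add: mult_ac)
  also have "\<dots> = (L / 2 - L / \<gamma> + stale_coeff) * A j"
    by (simp add: algebra_simps)
  also have "\<dots> \<le> 0"
  proof -
    have "0 \<le> \<gamma> * (real \<tau> * \<rho> ^ \<tau> / N + 2 * stale_coeff * real \<tau> / (N * L))"
      using \<gamma> \<rho> N_pos L(2) stale_coeff_nonneg by simp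
    moreover have "0 \<le> \<gamma> * (stale_coeff / L)"
      using \<gamma> L(2) stale_coeff_nonneg by simp
    moreover have "\<gamma> * (1 + 2 * stale_coeff / L + real \<tau> * \<rho> ^ \<tau> / N
        + 2 * stale_coeff * real \<tau> / (N * L))
      = \<gamma> + 2 * (\<gamma> * (stale_coeff / L))
        + \<gamma> * (real \<tau> * \<rho> ^ \<tau> / N + 2 * stale_coeff * real \<tau> / (N * L))"
      by (simp add: algebra_simps)
    \<comment> \<open>Nonpositivity of the factor, multiplied by \<open>\<gamma> / L\<close>;
      \<open>stale_bound\<close> gives it with room to spare.\<close>
    ultimately have "\<gamma> / 2 + \<gamma> * (stale_coeff / L) \<le> 1"
      using stale_bound \<gamma> by linarith
    then have "L / 2 - L / \<gamma> + stale_coeff \<le> 0"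
      using \<gamma> L(2) by (simp add: field_simps)
    then show ?thesis
      using A_nonneg by (rule mult_nonpos_nonneg)
  qed
  finally show ?thesis
    using N_pos by (simp add: divide_right_mono)
qed

lemma expectation_f_antimono: "m \<le> j \<Longrightarrow> (\<integral>\<omega>. f (x j \<omega>) \<partial>M) \<le> (\<integral>\<omega>. f (x m \<omega>) \<partial>M)"
  by (induction j rule: dec_induct) (auto intro: order_trans expectation_f_antimono_Suc)

text \<open>Convexity at the read point compares \<open>f p\<close> with \<open>f (x (k j))\<close>.
  Following the path from there to \<open>x j\<close>, the coordinate Lipschitz bound replaces
  \<open>f (x (k j))\<close> by \<open>f (x j)\<close> at the price of one curvature term and one
  gradient error per step.\<close>

lemma stale_linearization_le:
  assumes p: "p \<in> \<Omega>" and \<omega>: "\<omega> \<in> space M"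
  shows "g (x (k j) \<omega>) \<bullet> (p - x j \<omega>) \<le> f p - f (x j \<omega>)
    + (\<Sum>m\<in>{k j..<j}. L / 2 * (step_length m \<omega>)\<^sup>2
        + (g (x (k j) \<omega>) - g (x m \<omega>)) $ i m \<omega> * D m \<omega> $ i m \<omega>)"
proof -
  let ?z = "x (k j) \<omega>"
  have "g ?z \<bullet> (?z - x b \<omega>) \<le> f ?z - f (x b \<omega>)
    + (\<Sum>m\<in>{k j..<b}. L / 2 * (step_length m \<omega>)\<^sup>2 + (g ?z - g (x m \<omega>)) $ i m \<omega> * D m \<omega> $ i m \<omega>)"
    if "k j \<le> b" for b
    using that
  proof (induction b rule: dec_induct)
    case (step b)
    have "?z - x (Suc b) \<omega> = (?z - x b \<omega>) + (D b \<omega> $ i b \<omega>) *\<^sub>R axis (i b \<omega>) 1"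
      by (simp add: x_step[OF \<omega>])
    then have "g ?z \<bullet> (?z - x (Suc b) \<omega>) = g ?z \<bullet> (?z - x b \<omega>) + g ?z $ i b \<omega> * D b \<omega> $ i b \<omega>"
      by (simp only: inner_add_right inner_scaleR_right inner_axis) simp
    then show ?case
      using step f_step_le[OF \<omega>, of b] step_length_eq[OF \<omega>, of b] by (simp add: left_diff_distrib)
  qed simp
  from this[OF delay(1)] have "g ?z \<bullet> (?z - x j \<omega>) \<le> f ?z - f (x j \<omega>)
    + (\<Sum>m\<in>{k j..<j}. L / 2 * (step_length m \<omega>)\<^sup>2 + (g ?z - g (x m \<omega>)) $ i m \<omega> * D m \<omega> $ i m \<omega>)" .
  moreover have "f p \<ge> f ?z + g ?z \<bullet> (p - ?z)"
    using p x_in[OF \<omega>, of "k j"] U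
    by (intro convex_on_ge_linearization[OF U(1) convex_f] gradient) auto
  moreover have "g ?z \<bullet> (p - x j \<omega>) = g ?z \<bullet> (p - ?z) + g ?z \<bullet> (?z - x j \<omega>)"
    by (simp flip: inner_add_right)
  ultimately show ?thesis by linarith
qed

text \<open>Each error term is averaged over its own index \<open>i m\<close>. The point
  \<open>p\<close> is random because it will be the projection of \<open>x j\<close> onto the
  minimizers.\<close>

lemma expectation_stale_linearization_le:
  assumes p: "\<And>\<omega>. \<omega> \<in> space M \<Longrightarrow> p \<omega> \<in> \<Omega>" "\<And>\<omega>. \<omega> \<in> space M \<Longrightarrow> f (p \<omega>) = fs"
    and past_p: "past j p"
  shows "(\<integral>\<omega>. g (x (k j) \<omega>) \<bullet> (p \<omega> - x j \<omega>) \<partial>M) \<le> fs - (\<integral>\<omega>. f (x j \<omega>) \<partial>M)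
    + real \<tau> * (L / 2 * \<rho> ^ \<tau> / N + stale_coeff / N) * A j"
proof -
  define F where "F m \<omega> c = (g (x (k j) \<omega>) - g (x m \<omega>)) $ c * D m \<omega> $ c" for m \<omega> c
  \<comment> \<open>The read iterate is already determined at time \<open>m\<close> because
    \<open>k j \<le> m\<close>.\<close>
  have F: "past m (F m)" if "k j \<le> m" for m
  proof -
    have "past m (\<lambda>\<omega>. g (x (k j) \<omega>) - g (x m \<omega>))"
      by (intro past_intros; use that in simp)
    then show ?thesis
      using determined_by_past_compose2[OF _ past_D[OF order_refl],
          of m _ "\<lambda>u e c. u $ c * e $ c"] unfolding F_def[abs_def] by blast
  qed
  have int_F: "integrable M (\<lambda>\<omega>. F m \<omega> (i m \<omega>))" if "k j \<le> m" for m
    by (rule integrable_past[of "Suc m"], rule determined_by_past_compose2[OF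
          determined_by_past_mono[OF F[OF that]] determined_by_past_index]) simp
  have E_F: "(\<integral>\<omega>. F m \<omega> (i m \<omega>) \<partial>M) \<le> stale_coeff / N * A j" if "m \<in> {k j..<j}" for m
  proof -
    have "(\<integral>\<omega>. F m \<omega> (i m \<omega>) \<partial>M) = (\<integral>\<omega>. (g (x (k j) \<omega>) - g (x m \<omega>)) \<bullet> D m \<omega> \<partial>M) / N"
      using integral_at_index[OF F[of m]] that N by (simp add: F_def inner_vec_def)
    also have "\<dots> \<le> stale_coeff * A j / N"
      using expectation_gradient_error_le[of j m] that N_pos unfolding stale_coeff_def
      by (intro divide_right_mono) (auto simp: mult_ac)
    finally show ?thesis by simp
  qed
  have "(\<integral>\<omega>. g (x (k j) \<omega>) \<bullet> (p \<omega> - x j \<omega>) \<partial>M) \<le> (\<integral>\<omega>. fs - f (x j \<omega>)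
    + (\<Sum>m\<in>{k j..<j}. L / 2 * (step_length m \<omega>)\<^sup>2 + F m \<omega> (i m \<omega>)) \<partial>M)"
  proof (rule integral_mono)
    show "integrable M (\<lambda>\<omega>. g (x (k j) \<omega>) \<bullet> (p \<omega> - x j \<omega>))"
      by (rule integrable_past[of j]) (intro past_intros past_p; use delay in simp)
    show "integrable M (\<lambda>\<omega>. fs - f (x j \<omega>)
        + (\<Sum>m\<in>{k j..<j}. L / 2 * (step_length m \<omega>)\<^sup>2 + F m \<omega> (i m \<omega>)))"
      by (intro Bochner_Integration.integrable_add Bochner_Integration.integrable_diff
          Bochner_Integration.integrable_sum integrable_mult_right integrable_const
          integrable_f integrable_step_length int_F) simp
  next
    fix \<omega> assume \<omega>: "\<omega> \<in> space M"
    show "g (x (k j) \<omega>) \<bullet> (p \<omega> - x j \<omega>) \<le> fs - f (x j \<omega>)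
        + (\<Sum>m\<in>{k j..<j}. L / 2 * (step_length m \<omega>)\<^sup>2 + F m \<omega> (i m \<omega>))"
      using stale_linearization_le[OF p(1)[OF \<omega>] \<omega>, of j] p(2)[OF \<omega>] unfolding F_def by simp
  qed
  also have "\<dots> = fs - (\<integral>\<omega>. f (x j \<omega>) \<partial>M)
      + (\<Sum>m\<in>{k j..<j}. L / 2 * (A m / N) + (\<integral>\<omega>. F m \<omega> (i m \<omega>) \<partial>M))"
  proof -
    have "integrable M (\<lambda>\<omega>. L / 2 * (step_length m \<omega>)\<^sup>2 + F m \<omega> (i m \<omega>))" if "m \<in> {k j..<j}" for m
      using that int_F[of m] integrable_step_length by simp
    moreover have "(\<integral>\<omega>. L / 2 * (step_length m \<omega>)\<^sup>2 + F m \<omega> (i m \<omega>) \<partial>M)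
        = L / 2 * (A m / N) + (\<integral>\<omega>. F m \<omega> (i m \<omega>) \<partial>M)" if "m \<in> {k j..<j}" for m
      using that int_F[of m] integrable_step_length by (simp flip: expectation_step_length_power2)
    moreover have "(\<integral>\<omega>. fs - f (x j \<omega>) \<partial>M) = fs - (\<integral>\<omega>. f (x j \<omega>) \<partial>M)"
      using integrable_f by (simp add: prob_space)
    ultimately show ?thesis
      using integrable_f
      by (subst Bochner_Integration.integral_add)
         (auto simp del: Bochner_Integration.integral_add)
  qed
  also have "(\<Sum>m\<in>{k j..<j}. L / 2 * (A m / N) + (\<integral>\<omega>. F m \<omega> (i m \<omega>) \<partial>M))
      \<le> real (card {k j..<j}) * (L / 2 * (\<rho> ^ \<tau> * A j / N) + stale_coeff / N * A j)"
    using delay(2)[of j] L(2) N_pos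
    by (intro sum_bounded_above add_mono E_F mult_left_mono divide_right_mono A_le) auto
  also have "\<dots> \<le> real \<tau> * (L / 2 * (\<rho> ^ \<tau> * A j / N) + stale_coeff / N * A j)"
    using delay(2)[of j] L(2) N_pos \<rho> A_nonneg[of j] stale_coeff_nonneg by (intro mult_right_mono) auto
  finally show ?thesis
    by (simp add: algebra_simps)
qed

text \<open>The change is arranged as a function of the selected index, ready for averaging. The
  coefficient \<open>- (1 - \<gamma>)\<close> joins \<open>- 1\<close> from the projection
  inequality with \<open>\<gamma>\<close> from the curvature of \<open>f\<close>.\<close>

lemma distance_step_le:
  assumes p: "p \<in> \<Omega>" and \<omega>: "\<omega> \<in> space M"
  shows "(norm (x (Suc j) \<omega> - p))\<^sup>2 + 2 * \<gamma> / L * f (x (Suc j) \<omega>)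
    \<le> (norm (x j \<omega> - p))\<^sup>2 + 2 * \<gamma> / L * f (x j \<omega>) + (- (1 - \<gamma>) * (D j \<omega> $ i j \<omega>)\<^sup>2
      + 2 * \<gamma> / L * (g (x (k j) \<omega>) $ i j \<omega> * (p - x j \<omega>) $ i j \<omega>
        + (g (x (k j) \<omega>) - g (x j \<omega>)) $ i j \<omega> * D j \<omega> $ i j \<omega>))"
proof -
  define c where "c = i j \<omega>"
  define d where "d = D j \<omega> $ c"
  define e where "e = (p - x j \<omega>) $ c"
  define G where "G = g (x (k j) \<omega>) $ c"
  define h where "h = g (x j \<omega>) $ c"
  have e1: "x (Suc j) \<omega> - p = (x j \<omega> - p) - d *\<^sub>R axis c 1"
    unfolding d_def c_def by (simp add: x_step[OF \<omega>])
  have e2: "(norm (v - d *\<^sub>R axis c 1))\<^sup>2 = (norm v)\<^sup>2 - 2 * (d * v $ c) + d\<^sup>2"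
    for v :: "real ^ 'n"
    unfolding power2_norm_eq_inner
    by (simp add: inner_diff_left inner_diff_right inner_axis inner_axis' power2_eq_square
        algebra_simps)
  have "(x j \<omega> - p) $ c = - e"
    unfolding e_def by simp
  then have 1: "(norm (x (Suc j) \<omega> - p))\<^sup>2 = (norm (x j \<omega> - p))\<^sup>2 + 2 * (d * e) + d\<^sup>2"
    unfolding e1 e2 by simp
  have 2: "(e + d) * d \<le> \<gamma> / L * (G * (e + d))"
    using variational_inequality[OF \<omega> p, of c j] unfolding d_def e_def G_def by simp
  have 3: "2 * \<gamma> / L * f (x (Suc j) \<omega>) \<le> 2 * \<gamma> / L * (f (x j \<omega>) - h * d + L / 2 * d\<^sup>2)"
    using f_step_le[OF \<omega>, of j] \<gamma> L(2) unfolding d_def h_def c_def by (intro mult_left_mono) auto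
  have "2 * \<gamma> / L * (f (x j \<omega>) - h * d + L / 2 * d\<^sup>2)
      = 2 * \<gamma> / L * f (x j \<omega>) - 2 * \<gamma> / L * (h * d) + \<gamma> * d\<^sup>2"
    using L(2) by (simp add: field_simps)
  \<comment> \<open>The left side equals \<open>2 * ((e + d) * d) - d\<^sup>2\<close>, whose product
    the variational inequality bounds.\<close>
  moreover have "2 * (d * e) + d\<^sup>2 \<le> 2 * \<gamma> / L * (G * e + G * d) - d\<^sup>2"
  proof -
    have "2 * (d * e) + d\<^sup>2 = 2 * ((e + d) * d) - d\<^sup>2"
      by (simp add: algebra_simps power2_eq_square)
    moreover have "2 * \<gamma> / L * (G * e + G * d) = 2 * (\<gamma> / L * (G * (e + d)))"
      by (simp add: distrib_left)
    ultimately show ?thesis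
      using 2 by linarith
  qed
  ultimately have "(norm (x (Suc j) \<omega> - p))\<^sup>2 + 2 * \<gamma> / L * f (x (Suc j) \<omega>)
    \<le> (norm (x j \<omega> - p))\<^sup>2 + 2 * \<gamma> / L * f (x j \<omega>)
      + (- (1 - \<gamma>) * d\<^sup>2 + 2 * \<gamma> / L * (G * e + (G - h) * d))"
    using 1 3 by (simp add: algebra_simps)
  then show ?thesis
    unfolding d_def e_def G_def h_def c_def by simp
qed

section \<open>The Lyapunov function\<close>

abbreviation "S \<equiv> minimizers f \<Omega>"

definition "V fs j = (\<integral>\<omega>. (norm (x j \<omega> - closest_point S (x j \<omega>)))\<^sup>2 \<partial>M)
  + 2 * \<gamma> / L * ((\<integral>\<omega>. f (x j \<omega>) \<partial>M) - fs)"

lemma minimizersD: "p \<in> S \<Longrightarrow> p \<in> \<Omega>" "p \<in> S \<Longrightarrow> y \<in> \<Omega> \<Longrightarrow> f p \<le> f y"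
  unfolding minimizers_def is_arg_min_linorder by auto

lemma closed_S: "closed S"
proof (rule closed_minimizers[OF closed_\<Omega>])
  have "isCont f y" if "y \<in> \<Omega>" for y
    using gradient[of y] U(2) that unfolding gderiv_def by (auto intro: has_derivative_continuous)
  then show "continuous_on \<Omega> f"
    by (simp add: continuous_at_imp_continuous_on)
qed

lemma integrable_distance: "integrable M (\<lambda>\<omega>. (norm (x j \<omega> - closest_point S (x j \<omega>)))\<^sup>2)"
  by (rule integrable_past[of j]) (intro past_intros; simp)

context
  fixes fs :: real
  assumes S: "S \<noteq> {}" and fs: "\<And>p. p \<in> S \<Longrightarrow> f p = fs"
begin

lemma closest_point_S: "closest_point S y \<in> S"
  by (rule closest_point_in_set[OF closed_S S])

lemma V_Suc_le: "V fs (Suc j) \<le> V fs j - 2 * \<gamma> / (L * N) * ((\<integral>\<omega>. f (x j \<omega>) \<partial>M) - fs)"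
proof -
  \<comment> \<open>The projection of the current iterate remains the reference point for the next
    one: it depends on the past only, and the new distance to \<open>S\<close> is at most the
    distance to it.\<close>
  define p where "p \<omega> = closest_point S (x j \<omega>)" for \<omega>
  have past_p: "past j p"
    unfolding p_def by (intro past_intros; simp)
  have pS: "p \<omega> \<in> S" for \<omega>
    unfolding p_def by (rule closest_point_S)
  define H where "H \<omega> c = - (1 - \<gamma>) * (D j \<omega> $ c)\<^sup>2
      + 2 * \<gamma> / L * (g (x (k j) \<omega>) $ c * (p \<omega> - x j \<omega>) $ c
        + (g (x (k j) \<omega>) - g (x j \<omega>)) $ c * D j \<omega> $ c)" for \<omega> c
  have H: "past j H"
  proof -
    have "past j (\<lambda>\<omega>. (D j \<omega>, g (x (k j) \<omega>)))" "past j (\<lambda>\<omega>. (p \<omega> - x j \<omega>, g (x j \<omega>)))"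
      by (intro determined_by_past_compose2[where h=Pair] past_intros past_p; use delay in simp)+
    then show ?thesis
      using determined_by_past_compose2[of M i j _ _ "\<lambda>(d, G) (e, h) c. - (1 - \<gamma>) * (d $ c)\<^sup>2
          + 2 * \<gamma> / L * (G $ c * e $ c + (G - h) $ c * d $ c)"]
      unfolding H_def[abs_def] by fastforce
  qed
  have int_H: "integrable M (\<lambda>\<omega>. H \<omega> (i j \<omega>))"
    by (rule integrable_past[of "Suc j"], rule determined_by_past_compose2[OF
          determined_by_past_mono[OF H] determined_by_past_index]) simp
  have int1: "integrable M (\<lambda>\<omega>. g (x (k j) \<omega>) \<bullet> (p \<omega> - x j \<omega>))"
    by (rule integrable_past[of j]) (intro past_intros past_p; use delay in simp)
  have int2: "integrable M (\<lambda>\<omega>. (g (x (k j) \<omega>) - g (x j \<omega>)) \<bullet> D j \<omega>)"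
    by (rule integrable_past[of j]) (intro past_intros; use delay in simp)
  let ?dist = "\<lambda>j \<omega>. (norm (x j \<omega> - closest_point S (x j \<omega>)))\<^sup>2"
  let ?E = "(\<integral>\<omega>. f (x j \<omega>) \<partial>M) - fs"
  have "(\<integral>\<omega>. ?dist (Suc j) \<omega> + 2 * \<gamma> / L * f (x (Suc j) \<omega>) \<partial>M)
      \<le> (\<integral>\<omega>. ?dist j \<omega> + 2 * \<gamma> / L * f (x j \<omega>) + H \<omega> (i j \<omega>) \<partial>M)"
  proof (rule integral_mono)
    fix \<omega> assume \<omega>: "\<omega> \<in> space M"
    have "norm (x (Suc j) \<omega> - closest_point S (x (Suc j) \<omega>)) \<le> norm (x (Suc j) \<omega> - p \<omega>)"
      using closest_point_le[OF closed_S pS] unfolding dist_norm .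
    then have "?dist (Suc j) \<omega> \<le> (norm (x (Suc j) \<omega> - p \<omega>))\<^sup>2"
      by (simp add: power_mono)
    then show "?dist (Suc j) \<omega> + 2 * \<gamma> / L * f (x (Suc j) \<omega>)
        \<le> ?dist j \<omega> + 2 * \<gamma> / L * f (x j \<omega>) + H \<omega> (i j \<omega>)"
      using distance_step_le[OF minimizersD(1)[OF pS[of \<omega>]] \<omega>, of j] unfolding H_def p_def by linarith
  qed (intro Bochner_Integration.integrable_add integrable_mult_right integrable_f
      integrable_distance int_H)+
  also have "\<dots> = (\<integral>\<omega>. ?dist j \<omega> \<partial>M) + 2 * \<gamma> / L * (\<integral>\<omega>. f (x j \<omega>) \<partial>M)
      + (\<integral>\<omega>. (\<Sum>c\<in>UNIV. H \<omega> c) \<partial>M) / N"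
    using integrable_f integrable_distance int_H integral_at_index[OF H] N by simp
  also have "(\<integral>\<omega>. (\<Sum>c\<in>UNIV. H \<omega> c) \<partial>M) = (\<integral>\<omega>. - (1 - \<gamma>) * (norm (D j \<omega>))\<^sup>2
      + 2 * \<gamma> / L * (g (x (k j) \<omega>) \<bullet> (p \<omega> - x j \<omega>)
        + (g (x (k j) \<omega>) - g (x j \<omega>)) \<bullet> D j \<omega>) \<partial>M)"
    unfolding H_def
    by (simp only: norm_power2_eq_sum inner_vec_def sum.distrib sum_distrib_left distrib_left
        inner_real_def)
  also have "\<dots> = - (1 - \<gamma>) * A j + 2 * \<gamma> / L * ((\<integral>\<omega>. g (x (k j) \<omega>) \<bullet> (p \<omega> - x j \<omega>) \<partial>M)
        + (\<integral>\<omega>. (g (x (k j) \<omega>) - g (x j \<omega>)) \<bullet> D j \<omega> \<partial>M))"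
    unfolding A_def using integrable_D int1 int2 by simp
  also have "\<dots> \<le> - (1 - \<gamma>) * A j + 2 * \<gamma> / L * ((- ?E
      + real \<tau> * (L / 2 * \<rho> ^ \<tau> / N + stale_coeff / N) * A j) + stale_coeff * A j)"
  proof -
    have "(\<integral>\<omega>. g (x (k j) \<omega>) \<bullet> (p \<omega> - x j \<omega>) \<partial>M)
        \<le> - ?E + real \<tau> * (L / 2 * \<rho> ^ \<tau> / N + stale_coeff / N) * A j"
      using expectation_stale_linearization_le[OF minimizersD(1)[OF pS] fs[OF pS] past_p] by simp
    moreover have "(\<integral>\<omega>. (g (x (k j) \<omega>) - g (x j \<omega>)) \<bullet> D j \<omega> \<partial>M) \<le> stale_coeff * A j"
      using expectation_gradient_error_le[OF delay(1) order_refl, of j]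
      unfolding stale_coeff_def by (simp add: mult_ac)
    ultimately show ?thesis
      using \<gamma> L(2) by (intro add_left_mono mult_left_mono add_mono) auto
  qed
  \<comment> \<open>The coefficient of \<open>A j\<close> becomes the left side of
    \<open>stale_bound\<close> minus 1.\<close>
  also have "\<dots> = (\<gamma> * (1 + 2 * stale_coeff / L + real \<tau> * \<rho> ^ \<tau> / N
      + 2 * stale_coeff * real \<tau> / (N * L)) - 1) * A j - 2 * \<gamma> / L * ?E"
    using L(2) N_pos by (simp add: field_simps)
  also have "\<dots> \<le> - 2 * \<gamma> / L * ?E"
    using mult_nonpos_nonneg[OF _ A_nonneg[of j]] stale_bound by simp
  finally have "(\<integral>\<omega>. ?dist (Suc j) \<omega> + 2 * \<gamma> / L * f (x (Suc j) \<omega>) \<partial>M)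
      \<le> (\<integral>\<omega>. ?dist j \<omega> \<partial>M) + 2 * \<gamma> / L * (\<integral>\<omega>. f (x j \<omega>) \<partial>M) + - 2 * \<gamma> / L * ?E / N"
    using N_pos by (simp add: divide_right_mono)
  moreover have "(\<integral>\<omega>. ?dist (Suc j) \<omega> + 2 * \<gamma> / L * f (x (Suc j) \<omega>) \<partial>M)
      = (\<integral>\<omega>. ?dist (Suc j) \<omega> \<partial>M) + 2 * \<gamma> / L * (\<integral>\<omega>. f (x (Suc j) \<omega>) \<partial>M)"
    using integrable_f integrable_distance by simp
  moreover have "- 2 * \<gamma> / L * ?E / N = - (2 * \<gamma> / (L * N) * ?E)"
    by simp
  ultimately show ?thesis
    unfolding V_def right_diff_distrib[of "2 * \<gamma> / L"] by linarith
qed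

section \<open>Rates from the decrease of \<open>V\<close>\<close>

lemma V_0: "V fs 0 = (norm (x0 - closest_point S x0))\<^sup>2 + 2 * \<gamma> / L * (f x0 - fs)"
proof -
  have "(\<integral>\<omega>. (norm (x 0 \<omega> - closest_point S (x 0 \<omega>)))\<^sup>2 \<partial>M)
      = (\<integral>\<omega>. (norm (x0 - closest_point S x0))\<^sup>2 \<partial>M)"
    by (intro Bochner_Integration.integral_cong) (simp_all add: x_0)
  moreover have "(\<integral>\<omega>. f (x 0 \<omega>) \<partial>M) = (\<integral>\<omega>. f x0 \<partial>M)"
    by (intro Bochner_Integration.integral_cong) (simp_all add: x_0)
  ultimately show ?thesis
    unfolding V_def by (simp add: prob_space)
qed

lemma V_ge: "2 * \<gamma> / L * ((\<integral>\<omega>. f (x j \<omega>) \<partial>M) - fs) \<le> V fs j"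
  unfolding V_def by simp

text \<open>The scaled gap \<open>E j\<close> is at most every earlier one and at most
  \<open>V fs j\<close>, so summing the decreases gives
  \<open>(1 + j / N) * E j \<le> V fs 0\<close>.\<close>

lemma sublinear_rate:
  "(\<integral>\<omega>. f (x j \<omega>) \<partial>M) - fs \<le> N * (L * V fs 0) / (2 * \<gamma> * (N + real j))"
proof -
  define E where "E m = 2 * \<gamma> / L * ((\<integral>\<omega>. f (x m \<omega>) \<partial>M) - fs)" for m
  have Suc: "V fs (Suc m) \<le> V fs m - E m / N" for m
    using V_Suc_le[of m] unfolding E_def by simp
  have mono: "E j \<le> E m" if "m \<le> j" for m
    unfolding E_def using \<gamma> L(2) expectation_f_antimono[OF that] by (intro mult_left_mono) auto
  have "V fs m \<le> V fs 0 - real m * (E j / N)" if "m \<le> j" for m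
    using that
  proof (induction m)
    case (Suc m)
    have "E j / N \<le> E m / N"
      using mono[of m] Suc.prems N_pos by (intro divide_right_mono) auto
    moreover have "real (Suc m) * (E j / N) = real m * (E j / N) + E j / N"
      by (simp add: algebra_simps add_divide_distrib)
    ultimately show ?case
      using Suc \<open>V fs (Suc m) \<le> V fs m - E m / N\<close> by linarith
  qed simp
  from this[of j] have "E j + real j * (E j / N) \<le> V fs 0"
    using V_ge[of j] unfolding E_def by simp
  then have "E j * (N + real j) \<le> N * V fs 0"
    using N_pos by (simp add: field_simps)
  then have "L * (E j * (N + real j)) \<le> L * (N * V fs 0)"
    using L(2) by simp
  moreover have "L * (E j * (N + real j))
      = ((\<integral>\<omega>. f (x j \<omega>) \<partial>M) - fs) * (2 * \<gamma> * (N + real j))"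
    unfolding E_def using L(2) by simp
  moreover have "2 * \<gamma> * (N + real j) > 0"
    using \<gamma> N_pos by simp
  ultimately show ?thesis
    by (simp add: pos_le_divide_eq mult.left_commute)
qed

lemma linear_rate:
  assumes l: "l > 0" "essentially_strongly_convex f g \<Omega> l"
  shows "V fs j \<le> (1 - l / (N * (l + inverse \<gamma> * L))) ^ j * V fs 0"
proof -
  \<comment> \<open>A point and its projection have the same projection, so strong convexity applies
    to this pair; the gradient term is nonnegative by optimality of the projection.\<close>
  have growth: "(norm (y - closest_point S y))\<^sup>2 \<le> 2 / l * (f y - fs)" if y: "y \<in> \<Omega>" for y
  proof -
    let ?p = "closest_point S y"
    have p: "?p \<in> S" "?p \<in> \<Omega>" "?p \<in> U"
      using closest_point_S minimizersD(1) U(2) by blast+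
    have "f y - f ?p \<ge> g ?p \<bullet> (y - ?p) + l / 2 * (norm (y - ?p))\<^sup>2"
      using l(2) y p closest_point_self[OF p(1)]
      unfolding essentially_strongly_convex_def by metis
    moreover have "g ?p \<bullet> (y - ?p) \<ge> 0"
      by (rule minimizer_variational_inequality[OF convex_\<Omega> p(1) y gradient[OF p(3)]])
    ultimately show ?thesis
      using l(1) fs[OF p(1)] by (simp add: field_simps)
  qed
  \<comment> \<open>\<open>V fs j\<close> is at most \<open>2 / l + 2 * \<gamma> / L\<close> times
    the gap; \<open>\<theta>\<close> is the fraction that scales this factor to
    \<open>2 * \<gamma> / L\<close>, which is \<open>N\<close> times the guaranteed
    decrease.\<close>
  define \<theta> where "\<theta> = l / (l + inverse \<gamma> * L)"
  have q: "l + inverse \<gamma> * L > 0" "inverse \<gamma> * L > 0"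
    using l(1) \<gamma> L(2) by (simp_all add: add_pos_pos)
  have \<theta>: "0 \<le> \<theta>" "\<theta> \<le> 1"
    unfolding \<theta>_def using l(1) q by (simp_all add: divide_le_eq_1)
  have "2 / l + 2 * \<gamma> / L = 2 * \<gamma> / L * ((l + inverse \<gamma> * L) / l)"
    using l(1) \<gamma> L(2) by (simp add: field_simps)
  then have \<theta>_mult: "\<theta> * (2 / l + 2 * \<gamma> / L) = 2 * \<gamma> / L"
    unfolding \<theta>_def using l(1) q(1) by simp
  have N1: "1 \<le> N"
    unfolding N by simp
  have rate: "1 - l / (N * (l + inverse \<gamma> * L)) = 1 - \<theta> / N"
    unfolding \<theta>_def by (simp add: mult.commute)
  have "\<theta> / N \<le> 1"
    using \<theta> N1 by simp
  \<comment> \<open>Nonnegativity allows the one-step contraction to be iterated.\<close>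
  then have nonneg: "0 \<le> 1 - \<theta> / N"
    by simp
  have Suc: "V fs (Suc j) \<le> (1 - \<theta> / N) * V fs j" for j
  proof -
    let ?E = "(\<integral>\<omega>. f (x j \<omega>) \<partial>M) - fs"
    have "(\<integral>\<omega>. (norm (x j \<omega> - closest_point S (x j \<omega>)))\<^sup>2 \<partial>M)
        \<le> (\<integral>\<omega>. 2 / l * (f (x j \<omega>) - fs) \<partial>M)"
    proof (rule integral_mono)
      fix \<omega> assume "\<omega> \<in> space M"
      then show "(norm (x j \<omega> - closest_point S (x j \<omega>)))\<^sup>2 \<le> 2 / l * (f (x j \<omega>) - fs)"
        by (intro growth x_in)
    qed (intro integrable_distance integrable_mult_right
        Bochner_Integration.integrable_diff integrable_f integrable_const)+
    also have "\<dots> = 2 / l * ?E"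
      using integrable_f by (simp add: prob_space)
    finally have "V fs j \<le> (2 / l + 2 * \<gamma> / L) * ?E"
      unfolding V_def by (simp add: distrib_right)
    then have "\<theta> * V fs j \<le> \<theta> * ((2 / l + 2 * \<gamma> / L) * ?E)"
      using \<theta>(1) by (rule mult_left_mono)
    also have "\<dots> = 2 * \<gamma> / L * ?E"
      using \<theta>_mult by (simp only: mult.assoc[symmetric])
    finally have "\<theta> * V fs j / N \<le> 2 * \<gamma> / L * ?E / N"
      using N_pos by (intro divide_right_mono) auto
    moreover have "2 * \<gamma> / L * ?E / N = 2 * \<gamma> / (L * N) * ?E"
      by simp
    moreover have "(1 - \<theta> / N) * V fs j = V fs j - \<theta> * V fs j / N"
      by (simp add: left_diff_distrib)
    ultimately show ?thesis
      using V_Suc_le[of j] by linarith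
  qed
  have "V fs j \<le> (1 - \<theta> / N) ^ j * V fs 0"
  proof (induction j)
    case (Suc j)
    have "V fs (Suc j) \<le> (1 - \<theta> / N) * ((1 - \<theta> / N) ^ j * V fs 0)"
      using Suc[THEN mult_left_mono, OF nonneg] \<open>V fs (Suc j) \<le> (1 - \<theta> / N) * V fs j\<close> by linarith
    then show ?case by simp
  qed simp
  then show ?thesis
    unfolding rate .
qed

end

end

section \<open>Specialization to the given constants and sequences\<close>

theorem theorem4:
  fixes I :: "'n::finite \<Rightarrow> real set"
    and f :: "real ^ 'n \<Rightarrow> real"
    and gradf :: "real ^ 'n \<Rightarrow> real ^ 'n"
    and \<Omega> U S :: "(real ^ 'n) set"
    and L :: "'n \<Rightarrow> real"
    and Lres Lmax fstar \<gamma> \<rho> \<psi> R0 :: real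
    and n \<tau> :: nat
    and k :: "nat \<Rightarrow> nat"
    and M :: "'w measure"
    and i :: "nat \<Rightarrow> 'w \<Rightarrow> 'n"
    and x0 :: "real ^ 'n"
    and x xbar :: "nat \<Rightarrow> 'w \<Rightarrow> real ^ 'n"
  assumes n_def: "n = CARD('n)" and n_ge: "n \<ge> 5"
    and I: "\<And>c. closed (I c)" "\<And>c. is_interval (I c)"
    and \<Omega>_def: "\<Omega> = interval_box I"
    and U: "open U" "\<Omega> \<subseteq> U"
    and f_convex: "convex_on U f"
    and f_smooth: "\<And>y. y \<in> U \<Longrightarrow> GDERIV f y :> gradf y" "continuous_on U gradf"
    and S_def: "S = minimizers f \<Omega>" and S_nonempty: "S \<noteq> {}"
    and fstar_def: "fstar = (INF y\<in>\<Omega>. f y)"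
    and Lres: "restricted_lipschitz gradf \<Omega> Lres" "Lres > 0"
    and L: "\<And>c. coordinate_lipschitz f gradf \<Omega> c (L c)"
    and Lmax_def: "Lmax = Max (range L)" and Lmax_pos: "Lmax > 0"
    and M: "prob_space M"
    and i_indep: "prob_space.indep_vars M (\<lambda>_. count_space UNIV) i UNIV"
    and i_uniform: "\<And>j c. measure M {\<omega> \<in> space M. i j \<omega> = c} = 1 / real n"
    and \<tau>: "\<tau> \<ge> 1"
    and k: "\<And>j. k j \<le> j" "\<And>j. j - k j \<le> \<tau>"
    and x0: "x0 \<in> \<Omega>"
    and x_0: "\<And>\<omega>. \<omega> \<in> space M \<Longrightarrow> x 0 \<omega> = x0"
    and x_Suc: "\<And>j \<omega>. \<omega> \<in> space M \<Longrightarrow>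
          x (Suc j) \<omega> = coordinate_update gradf \<Omega> \<gamma> Lmax (i j \<omega>) (x j \<omega>) (x (k j) \<omega>)"
    and xbar_Suc: "\<And>j \<omega>. \<omega> \<in> space M \<Longrightarrow>
          xbar (Suc j) \<omega> = full_update gradf \<Omega> \<gamma> Lmax (x j \<omega>) (x (k j) \<omega>)"
    and \<rho>: "\<rho> > inverse (1 - 2 / sqrt (real n))"
    and \<psi>_def: "\<psi> = 1 + Lres * real \<tau> * \<rho> ^ \<tau> / (sqrt (real n) * Lmax) *
          (2 + Lmax / (sqrt (real n) * Lres) + 2 * real \<tau> / real n)"
    and \<gamma>_pos: "\<gamma> > 0"
    and \<gamma>_le1: "\<gamma> \<le> 1 / \<psi>"
    and \<gamma>_le2: "\<gamma> \<le> (1 - 1 / \<rho> - 2 / sqrt (real n)) *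
          (sqrt (real n) * Lmax / (4 * Lres * real \<tau> * \<rho> ^ \<tau>))"
    and R0_def: "R0 = norm (x0 - closest_point S x0)"
  shows "(\<forall>j\<ge>1. (\<integral>\<omega>. (norm (x (j - 1) \<omega> - xbar j \<omega>))\<^sup>2 \<partial>M)
                  \<le> \<rho> * (\<integral>\<omega>. (norm (x j \<omega> - xbar (j + 1) \<omega>))\<^sup>2 \<partial>M))
       \<and> (\<forall>l>0. essentially_strongly_convex f gradf \<Omega> l \<longrightarrow>
            (\<forall>j\<ge>1. (\<integral>\<omega>. (norm (x j \<omega> - closest_point S (x j \<omega>)))\<^sup>2 \<partial>M)
                      + 2 * \<gamma> / Lmax * ((\<integral>\<omega>. f (x j \<omega>) \<partial>M) - fstar)
                    \<le> (1 - l / (real n * (l + inverse \<gamma> * Lmax))) ^ j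
                      * (R0\<^sup>2 + 2 * \<gamma> / Lmax * (f x0 - fstar))))
       \<and> (\<forall>j. (\<integral>\<omega>. f (x j \<omega>) \<partial>M) - fstar
                \<le> real n * (R0\<^sup>2 * Lmax + 2 * \<gamma> * (f x0 - fstar)) / (2 * \<gamma> * (real n + real j)))"
proof -
  interpret prob_space M by (rule M)
  have n: "n = real CARD('n)"
    unfolding n_def ..
  \<comment> \<open>\<open>n \<ge> 5\<close> makes \<open>1 - 2 / sqrt n\<close> positive and at
    most 1, so its inverse, and with it \<open>\<rho>\<close>, is at least 1.\<close>
  have "sqrt 4 < sqrt (real n)"
    using n_ge by (intro real_sqrt_less_mono) simp
  then have sqrt_n: "2 < sqrt (real n)"
    by simp
  then have "0 < sqrt (real n)"
    by linarith
  with sqrt_n have "0 < 1 - 2 / sqrt (real n)" "1 - 2 / sqrt (real n) \<le> 1"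
    by (simp_all add: divide_less_eq_1_pos)
  then have \<rho>1: "\<rho> \<ge> 1"
    using \<rho> one_le_inverse[of "1 - 2 / sqrt (real n)"] by linarith
  have "\<psi> \<ge> 1"
    unfolding \<psi>_def using \<rho>1 Lres(2) Lmax_pos by simp
  then have \<gamma>\<psi>: "\<gamma> * \<psi> \<le> 1"
    using \<gamma>_le1 by (simp add: field_simps)
  have q: "4 * Lres * real \<tau> * \<rho> ^ \<tau> > 0"
    using Lres(2) \<tau> \<rho>1 by simp
  have Lmax: "coordinate_lipschitz f gradf \<Omega> c Lmax" for c
    unfolding coordinate_lipschitz_def
  proof (intro allI ballI impI)
    fix t y assume y: "y \<in> \<Omega>" "y + t *\<^sub>R axis c 1 \<in> \<Omega>"
    have "L c \<le> Lmax"
      unfolding Lmax_def by simp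
    then have "L c / 2 * t\<^sup>2 \<le> Lmax / 2 * t\<^sup>2"
      by (intro mult_right_mono) auto
    then show "f (y + t *\<^sub>R axis c 1) - f y \<le> gradf y $ c * t + Lmax / 2 * t\<^sup>2"
      using L[of c] y unfolding coordinate_lipschitz_def by fastforce
  qed
  interpret async_coordinate_descent M i I \<Omega> U f gradf Lmax Lres \<gamma> \<rho> "real n" \<tau> k x0 x
  proof unfold_locales
    show "\<gamma> * Lres / Lmax * (4 * real \<tau> * \<rho> ^ \<tau>)
        \<le> (1 - 1 / \<rho> - 2 / sqrt (real n)) * sqrt (real n)"
    proof -
      have "\<gamma> * (4 * Lres * real \<tau> * \<rho> ^ \<tau>)
          \<le> (1 - 1 / \<rho> - 2 / sqrt (real n)) * sqrt (real n) * Lmax"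
        using \<gamma>_le2 q by (simp add: pos_le_divide_eq mult.assoc)
      then show ?thesis
        using Lmax_pos by (simp add: pos_divide_le_eq mult_ac)
    qed
  qed (use assms \<rho>1 Lmax \<gamma>\<psi> in \<open>simp_all add: n \<psi>_def\<close>)
  have "xbar (Suc j) \<omega> = closest_point \<Omega> (x j \<omega> - (\<gamma> / Lmax) *\<^sub>R gradf (x (k j) \<omega>))"
    if "\<omega> \<in> space M" for j \<omega>
    using xbar_Suc[OF that, of j]
      full_update_eq[OF convex_\<Omega> closed_\<Omega> nonempty_\<Omega> \<gamma>_pos Lmax_pos] by simp
  then have A: "(\<integral>\<omega>. (norm (x j \<omega> - xbar (Suc j) \<omega>))\<^sup>2 \<partial>M) = A j" for j
    unfolding A_def D_def by (intro Bochner_Integration.integral_cong) simp_all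
  \<comment> \<open>\<open>fstar\<close> is an infimum, attained at every minimizer.\<close>
  have fs: "f p = fstar" if "p \<in> minimizers f \<Omega>" for p
    unfolding fstar_def using minimizersD[OF that]
    by (intro cInf_eq_minimum[symmetric]) auto
  have ne: "minimizers f \<Omega> \<noteq> {}"
    using S_nonempty S_def by simp
  have V0: "V fstar 0 = R0\<^sup>2 + 2 * \<gamma> / Lmax * (f x0 - fstar)"
    using V_0[OF ne fs] unfolding R0_def S_def .
  \<comment> \<open>\<open>xbar (j + 1)\<close> belongs to \<open>A j\<close>, so the claim at
    \<open>j\<close> compares \<open>A (j - 1)\<close> with \<open>A j\<close>.\<close>
  have "(\<integral>\<omega>. (norm (x (j - 1) \<omega> - xbar j \<omega>))\<^sup>2 \<partial>M)
      \<le> \<rho> * (\<integral>\<omega>. (norm (x j \<omega> - xbar (j + 1) \<omega>))\<^sup>2 \<partial>M)" if "j \<ge> 1" for j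
    using A_ratio[of "j - 1"] A[of "j - 1"] A[of j] that by simp
  moreover have "(\<integral>\<omega>. (norm (x j \<omega> - closest_point S (x j \<omega>)))\<^sup>2 \<partial>M)
        + 2 * \<gamma> / Lmax * ((\<integral>\<omega>. f (x j \<omega>) \<partial>M) - fstar)
      \<le> (1 - l / (real n * (l + inverse \<gamma> * Lmax))) ^ j
        * (R0\<^sup>2 + 2 * \<gamma> / Lmax * (f x0 - fstar))"
    if "l > 0" "essentially_strongly_convex f gradf \<Omega> l" for l j
    using linear_rate[OF ne fs that, of j] unfolding V0 V_def[of fstar j] S_def .
  moreover have "(\<integral>\<omega>. f (x j \<omega>) \<partial>M) - fstar
      \<le> real n * (R0\<^sup>2 * Lmax + 2 * \<gamma> * (f x0 - fstar)) / (2 * \<gamma> * (real n + real j))" for j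
  proof -
    have "Lmax * V fstar 0 = R0\<^sup>2 * Lmax + 2 * \<gamma> * (f x0 - fstar)"
      unfolding V0 using Lmax_pos by (simp add: field_simps)
    then show ?thesis
      using sublinear_rate[OF ne fs, of j] by simp
  qed
  ultimately show ?thesis
    by blast
qed

end
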